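(* Let $B\subseteq\mathcal B(H)$ with $H$ finite-dimensional, and let $A\in\mathcal B(L^2(B))$ be self-adjoint with $m(A\otimes A)m^*=A$ and $(1\otimes\eta^*m)(1\otimes A\otimes1)(m^*\eta\otimes1)=A$. Let $e=\Psi_{0,1/2}(A)$ or $e=\Psi'_{1/2,0}(A)$, let $V\subseteq H\otimes\overline H$ be the image of $e$ acting on $H\otimes\overline H$, and let $S\subseteq\mathcal B(H)$ be the subspace corresponding to $V$ under $\mathcal B(H)\cong H\otimes\overline H$. Let $(e_j)$ be an orthonormal basis of $H$ and set $u_0=\sum_j e_j\otimes\overline{Q^{-1/2}(e_j)}$, $u_1=\sum_j Q^{-1/2}(e_j)\otimes\overline{e_j}$ in $H\otimes\overline H$. The following are equivalent: (1) $m(A\otimes1)m^*=1$ or, equivalently, $m(1\otimes A)m^*=1$; (2) $e(u_0)=u_0$ or, equivalently, $e(u_1)=u_1$; (3) $V$ contains $u_0$ or, equivalently, contains $u_1$; (4) $S$ contains $Q^{-1/2}$; (5) $\mathsf m\big((\sigma_{-i/2}\otimes\mathrm{id})(e)\big)=1$, where $\mathsf m:B\otimes B^{\mathrm{op}}\to B$, $a\otimes b\mapsto ab$, is the multiplication map.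
   Context: $B$ is a finite-dimensional $C^*$-algebra, $\mathrm{Tr}$ the sum of the non-normalised traces of its matrix blocks, $\psi$ a faithful state on $B$, $Q\in B$ the positive invertible element with $\psi(a)=\mathrm{Tr}(Qa)$, and $\sigma_z(a)=Q^{iz}aQ^{-iz}$ for $z\in\mathbb C$, $a\in B$. Inner products are linear in the right variable and $\theta_{\xi,\eta}(\zeta)=(\xi|\zeta)\eta$. $L^2(B)$ is the GNS space of $\psi$ with GNS map $\Lambda$ (a linear bijection), $(\Lambda(a)|\Lambda(b))=\psi(a^*b)$; $m:L^2(B)\otimes L^2(B)\to L^2(B)$ is $m(\Lambda(a)\otimes\Lambda(b))=\Lambda(ab)$ with Hilbert space adjoint $m^*$; $\eta:\mathbb C\to L^2(B)$, $\lambda\mapsto\lambda\Lambda(1)$, with adjoint $\eta^*$. $B^{\mathrm{op}}$ is $B$ with reversed product. $\Psi_{0,1/2},\Psi'_{1/2,0}:\mathcal B(L^2(B))\to B\otimes B^{\mathrm{op}}$ are the linear bijections with $\Psi_{0,1/2}(\theta_{\Lambda(a),\Lambda(b)})=a^*\otimes\sigma_{i/2}(b)$ and $\Psi'_{1/2,0}(\theta_{\Lambda(a),\Lambda(b)})=\sigma_{i/2}(b)\otimes a^*$. For $A$ as in the claim, $e$ is an orthogonal projection. $B$ is a unital $*$-subalgebra of $\mathcal B(H)$. $\overline H$ is the conjugate Hilbert space; $x^\top(\overline\xi)=\overline{x^*\xi}$ for $x\in\mathcal B(H)$; $B\otimes B^{\mathrm{op}}$ acts on $H\otimes\overline H$ via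 $a\otimes b\mapsto a\otimes b^\top$; $\mathcal B(H)\cong H\otimes\overline H$ via $\theta_{\xi,\eta}\mapsto\eta\otimes\overline\xi$. *)

theory Defs
  imports "HOL-Analysis.Analysis"
begin

text \<open>
  Finite-dimensional Hilbert spaces are coordinatised as \<open>complex ^ 'n\<close>, operators between them
  are matrices (\<open>complex ^ 'col ^ 'row\<close>), and the tensor product of \<open>complex ^ 'a\<close> and
  \<open>complex ^ 'b\<close> is \<open>complex ^ ('a \<times> 'b)\<close>.
\<close>

type_synonym 'n cmat = "complex ^ 'n ^ 'n"

definition cip :: "complex ^ 'n \<Rightarrow> complex ^ 'n \<Rightarrow> complex" where
  "cip x y = (\<Sum>i\<in>UNIV. cnj (x $ i) * y $ i)"

definition adj :: "complex ^ 'm ^ 'n \<Rightarrow> complex ^ 'n ^ 'm" where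
  "adj A = (\<chi> i j. cnj (A $ j $ i))"

definition msc :: "complex \<Rightarrow> complex ^ 'm ^ 'n \<Rightarrow> complex ^ 'm ^ 'n" where
  "msc c A = (\<chi> i j. c * A $ i $ j)"

definition theta :: "complex ^ 'm \<Rightarrow> complex ^ 'n \<Rightarrow> complex ^ 'm ^ 'n" where
  "theta \<xi> \<eta> = (\<chi> i j. \<eta> $ i * cnj (\<xi> $ j))"

lemma theta_apply: "theta \<xi> \<eta> *v \<zeta> = cip \<xi> \<zeta> *s \<eta>"
  by (simp add: theta_def cip_def vec_eq_iff matrix_vector_mult_def sum_distrib_left
      sum_distrib_right mult_ac)

lemma cip_adj: "cip (adj A *v x) y = cip x (A *v y)"
  unfolding cip_def adj_def matrix_vector_mult_def
  by (simp add: sum_distrib_left sum_distrib_right mult_ac) (rule sum.swap)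

definition vtens :: "complex ^ 'a \<Rightarrow> complex ^ 'b \<Rightarrow> complex ^ ('a::finite \<times> 'b::finite)" where
  "vtens x y = (\<chi> p. x $ fst p * y $ snd p)"

definition kron ::
  "complex ^ 'a::finite ^ 'c::finite \<Rightarrow> complex ^ 'b::finite ^ 'd::finite \<Rightarrow> complex ^ ('a \<times> 'b) ^ ('c \<times> 'd)" where
  "kron A B = (\<chi> p q. A $ fst p $ fst q * B $ snd p $ snd q)"

lemma cip_vtens: "cip (vtens x y) (vtens x' y') = cip x x' * cip y y'"
  by (simp add: cip_def vtens_def sum_product sum.cartesian_product mult_ac case_prod_beta)

lemma kron_vtens: "kron A B *v vtens x y = vtens (A *v x) (B *v y)"
  by (simp add: kron_def vtens_def vec_eq_iff matrix_vector_mult_def sum_product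
      sum.cartesian_product mult_ac case_prod_beta)

text \<open>The canonical unitaries \<open>K \<cong> \<complex> \<otimes> K\<close>, \<open>K \<otimes> \<complex> \<cong> K\<close> and
  \<open>(K \<otimes> L) \<otimes> M \<cong> K \<otimes> (L \<otimes> M)\<close>, where \<open>\<complex>\<close> is \<open>complex ^ 1\<close>.\<close>

definition lunit_inv :: "complex ^ 'a::finite ^ (1 \<times> 'a)" where
  "lunit_inv = (\<chi> p j. if snd p = j then 1 else 0)"

definition runit :: "complex ^ ('a::finite \<times> 1) ^ 'a" where
  "runit = (\<chi> i p. if i = fst p then 1 else 0)"

definition assoc :: "complex ^ (('a::finite \<times> 'b::finite) \<times> 'c::finite) ^ ('a \<times> ('b \<times> 'c))" where
  "assoc = (\<chi> p q. if p = (fst (fst q), (snd (fst q), snd q)) then 1 else 0)"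

lemma lunit_inv_apply: "lunit_inv *v x = vtens 1 x"
  by (simp add: lunit_inv_def vtens_def vec_eq_iff matrix_vector_mult_def if_distrib
      if_distribR cong: if_cong)

lemma runit_apply: "runit *v vtens x c = c $ 1 *s x"
proof -
  have "(\<Sum>p\<in>UNIV. runit $ i $ p * vtens x c $ p) = c $ 1 * x $ i" for i
  proof -
    have "(\<Sum>p\<in>UNIV. runit $ i $ p * vtens x c $ p) = (\<Sum>p\<in>{(i, 1::1)}. runit $ i $ p * vtens x c $ p)"
      by (rule sum.mono_neutral_right) (auto simp: runit_def intro: prod_eqI)
    then show ?thesis by (simp add: runit_def vtens_def)
  qed
  then show ?thesis by (simp add: vec_eq_iff matrix_vector_mult_def)
qed

lemma assoc_apply: "assoc *v vtens (vtens x y) z = vtens x (vtens y z)"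
proof -
  have "(\<Sum>q\<in>UNIV. assoc $ p $ q * vtens (vtens x y) z $ q) = vtens x (vtens y z) $ p" for p
  proof -
    have "(\<Sum>q\<in>UNIV. assoc $ p $ q * vtens (vtens x y) z $ q)
        = (\<Sum>q\<in>{((fst p, fst (snd p)), snd (snd p))}. assoc $ p $ q * vtens (vtens x y) z $ q)"
      by (rule sum.mono_neutral_right) (auto simp: assoc_def)
    then show ?thesis by (simp add: assoc_def vtens_def mult_ac)
  qed
  then show ?thesis by (simp add: vec_eq_iff matrix_vector_mult_def)
qed


text \<open>The conjugate Hilbert space of \<open>complex ^ 'n\<close> is again \<open>complex ^ 'n\<close>, the canonical
  antiunitary being coordinatewise conjugation.  With this identification the operator
  \<open>x\<^sup>\<top>\<close> is given by the transposed matrix.\<close>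

definition cbar :: "complex ^ 'n \<Rightarrow> complex ^ 'n" where
  "cbar x = (\<chi> i. cnj (x $ i))"

lemma transpose_cbar: "transpose x *v cbar \<xi> = cbar (adj x *v \<xi>)"
  by (simp add: cbar_def adj_def transpose_def vec_eq_iff matrix_vector_mult_def)

definition hs_vec :: "'n::finite cmat \<Rightarrow> complex ^ ('n::finite \<times> 'n)" where
  "hs_vec T = (\<chi> p. T $ fst p $ snd p)"

lemma hs_vec_theta: "hs_vec (theta \<xi> \<eta>) = vtens \<eta> (cbar \<xi>)"
  by (simp add: hs_vec_def theta_def vtens_def cbar_def vec_eq_iff)

definition orthonormal_basis :: "('j::finite \<Rightarrow> complex ^ 'n) \<Rightarrow> bool" where
  "orthonormal_basis b \<longleftrightarrow>
     (\<forall>i j. cip (b i) (b j) = (if i = j then 1 else 0)) \<and> vec.span (range b) = UNIV"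


definition unital_star_subalgebra :: "'n::finite cmat set \<Rightarrow> bool" where
  "unital_star_subalgebra B \<longleftrightarrow> mat 1 \<in> B \<and>
     (\<forall>a\<in>B. \<forall>b\<in>B. a + b \<in> B \<and> a ** b \<in> B) \<and>
     (\<forall>c. \<forall>a\<in>B. msc c a \<in> B) \<and> (\<forall>a\<in>B. adj a \<in> B)"

text \<open>The direct sum of the full matrix algebras of sizes \<open>n 0, \<dots>, n (k - 1)\<close>: an element \<open>x\<close>
  has the entry \<open>x i r s\<close> in row \<open>r\<close> and column \<open>s\<close> of block \<open>i\<close>.\<close>

type_synonym blocks = "nat \<Rightarrow> nat \<Rightarrow> nat \<Rightarrow> complex"

definition multimatrix :: "nat \<Rightarrow> (nat \<Rightarrow> nat) \<Rightarrow> blocks set" where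
  "multimatrix k n = {x. \<forall>i r s. x i r s \<noteq> 0 \<longrightarrow> i < k \<and> r < n i \<and> s < n i}"

definition block_iso :: "nat \<Rightarrow> (nat \<Rightarrow> nat) \<Rightarrow> 'n::finite cmat set \<Rightarrow> (blocks \<Rightarrow> 'n cmat) \<Rightarrow> bool" where
  "block_iso k n B \<phi> \<longleftrightarrow> bij_betw \<phi> (multimatrix k n) B \<and>
     (\<forall>x\<in>multimatrix k n. \<forall>y\<in>multimatrix k n.
        \<phi> (\<lambda>i r s. x i r s + y i r s) = \<phi> x + \<phi> y \<and>
        \<phi> (\<lambda>i r s. \<Sum>t<n i. x i r t * y i t s) = \<phi> x ** \<phi> y) \<and>
     (\<forall>c. \<forall>x\<in>multimatrix k n. \<phi> (\<lambda>i r s. c * x i r s) = msc c (\<phi> x)) \<and>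
     (\<forall>x\<in>multimatrix k n. \<phi> (\<lambda>i r s. cnj (x i s r)) = adj (\<phi> x))"

text \<open>\<open>Tr\<close> is, on \<open>B\<close>, the sum of the non-normalised traces of the matrix blocks of \<open>B\<close>.
  In general this is not the trace of \<open>B\<close> as an algebra of matrices, since a block may occur with
  multiplicity in the given representation.\<close>

definition is_block_trace :: "'n::finite cmat set \<Rightarrow> ('n cmat \<Rightarrow> complex) \<Rightarrow> bool" where
  "is_block_trace B Tr \<longleftrightarrow>
     (\<exists>k n \<phi>. block_iso k n B \<phi> \<and> (\<forall>x\<in>multimatrix k n. Tr (\<phi> x) = (\<Sum>i<k. \<Sum>r<n i. x i r r)))"

definition faithful_state :: "'n::finite cmat set \<Rightarrow> ('n cmat \<Rightarrow> complex) \<Rightarrow> bool" where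
  "faithful_state B \<psi> \<longleftrightarrow>
     (\<forall>a\<in>B. \<forall>b\<in>B. \<psi> (a + b) = \<psi> a + \<psi> b) \<and> (\<forall>c. \<forall>a\<in>B. \<psi> (msc c a) = c * \<psi> a) \<and>
     \<psi> (mat 1) = 1 \<and>
     (\<forall>a\<in>B. \<psi> (adj a ** a) \<in> \<real>\<^sub>\<ge>\<^sub>0) \<and> (\<forall>a\<in>B. \<psi> (adj a ** a) = 0 \<longrightarrow> a = 0)"

definition positive_op :: "'n::finite cmat \<Rightarrow> bool" where
  "positive_op Q \<longleftrightarrow> (\<forall>x. cip x (Q *v x) \<in> \<real>\<^sub>\<ge>\<^sub>0)"

text \<open>Functional calculus: \<open>mpow Q z\<close> acts on each eigenspace of \<open>Q\<close>, with eigenvalue \<open>l\<close>, as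
  multiplication by \<open>l powr z\<close>.  It is meant for positive invertible \<open>Q\<close>; then the eigenvectors
  span the space and the eigenvalues are strictly positive reals.\<close>

definition mpow :: "'n::finite cmat \<Rightarrow> complex \<Rightarrow> 'n cmat" where
  "mpow Q z = (THE X. \<forall>l v. Q *v v = l *s v \<longrightarrow> X *v v = (l powr z) *s v)"

definition sigma_aut :: "'n::finite cmat \<Rightarrow> complex \<Rightarrow> 'n cmat \<Rightarrow> 'n cmat" where
  "sigma_aut Q z a = mpow Q (\<i> * z) ** a ** mpow Q (- (\<i> * z))"


definition gns_map ::
  "'n::finite cmat set \<Rightarrow> ('n cmat \<Rightarrow> complex) \<Rightarrow> ('n cmat \<Rightarrow> complex ^ 'd::finite) \<Rightarrow> bool" where
  "gns_map B \<psi> \<Lambda> \<longleftrightarrow> bij_betw \<Lambda> B UNIV \<and>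
     (\<forall>a\<in>B. \<forall>b\<in>B. \<Lambda> (a + b) = \<Lambda> a + \<Lambda> b) \<and> (\<forall>c. \<forall>a\<in>B. \<Lambda> (msc c a) = c *s \<Lambda> a) \<and>
     (\<forall>a\<in>B. \<forall>b\<in>B. cip (\<Lambda> a) (\<Lambda> b) = \<psi> (adj a ** b))"

definition gns_inv :: "'n::finite cmat set \<Rightarrow> ('n cmat \<Rightarrow> complex ^ 'd::finite) \<Rightarrow> 'd \<Rightarrow> 'n cmat" where
  "gns_inv B \<Lambda> i = inv_into B \<Lambda> (axis i 1)"

text \<open>The matrices of \<open>m\<close> and \<open>\<eta>\<close>, and the linear maps \<open>\<Psi>\<^sub>0\<^sub>,\<^sub>1\<^sub>/\<^sub>2\<close> and \<open>\<Psi>'\<^sub>1\<^sub>/\<^sub>2\<^sub>,\<^sub>0\<close>, are given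
  by their values on the standard basis of \<open>complex ^ 'd\<close>, respectively on the matrix units
  \<open>theta (axis j 1) (axis i 1)\<close>; the lemmas \<open>mult_op_vtens\<close>, \<open>unit_op_apply\<close>,
  \<open>Psi_theta\<close> and \<open>Psi'_theta\<close> give their values on arbitrary elements.\<close>

definition mult_op :: "'n::finite cmat set \<Rightarrow> ('n cmat \<Rightarrow> complex ^ 'd::finite) \<Rightarrow> complex ^ ('d \<times> 'd) ^ 'd" where
  "mult_op B \<Lambda> = (\<chi> k p. \<Lambda> (gns_inv B \<Lambda> (fst p) ** gns_inv B \<Lambda> (snd p)) $ k)"

definition unit_op :: "('n::finite cmat \<Rightarrow> complex ^ 'd::finite) \<Rightarrow> complex ^ 1 ^ 'd" where
  "unit_op \<Lambda> = (\<chi> i j. \<Lambda> (mat 1) $ i)"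

text \<open>An element of \<open>B \<otimes> B\<^sup>o\<^sup>p\<close> is represented by the element of
  \<open>complex ^ ('n \<times> 'n) ^ ('n \<times> 'n)\<close> obtained from \<open>a \<otimes> b \<mapsto> kron a b\<close>.  This linear
  embedding ignores the reversal of the product in the second leg, which is
  accounted for in \<open>op_action\<close> (via \<open>b \<mapsto> b\<^sup>\<top>\<close>).\<close>

definition Psi ::
  "'n::finite cmat \<Rightarrow> 'n cmat set \<Rightarrow> ('n cmat \<Rightarrow> complex ^ 'd::finite) \<Rightarrow> 'd cmat \<Rightarrow> ('n::finite \<times> 'n) cmat" where
  "Psi Q B \<Lambda> A = (\<Sum>i\<in>UNIV. \<Sum>j\<in>UNIV. msc (A $ i $ j)
     (kron (adj (gns_inv B \<Lambda> j)) (sigma_aut Q (\<i> / 2) (gns_inv B \<Lambda> i))))"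

definition Psi' ::
  "'n::finite cmat \<Rightarrow> 'n cmat set \<Rightarrow> ('n cmat \<Rightarrow> complex ^ 'd::finite) \<Rightarrow> 'd cmat \<Rightarrow> ('n::finite \<times> 'n) cmat" where
  "Psi' Q B \<Lambda> A = (\<Sum>i\<in>UNIV. \<Sum>j\<in>UNIV. msc (A $ i $ j)
     (kron (sigma_aut Q (\<i> / 2) (gns_inv B \<Lambda> i)) (adj (gns_inv B \<Lambda> j))))"

definition op_action :: "('n::finite \<times> 'n) cmat \<Rightarrow> ('n::finite \<times> 'n) cmat" where
  "op_action e = (\<chi> p q. e $ (fst p, snd q) $ (fst q, snd p))"

definition left_amp :: "('n::finite cmat \<Rightarrow> 'n cmat) \<Rightarrow> ('n::finite \<times> 'n) cmat \<Rightarrow> ('n::finite \<times> 'n) cmat" where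
  "left_amp f e = (\<chi> p q. f (\<chi> i j. e $ (i, snd p) $ (j, snd q)) $ fst p $ fst q)"

definition mult_map :: "('n::finite \<times> 'n) cmat \<Rightarrow> 'n::finite cmat" where
  "mult_map e = (\<chi> i j. \<Sum>k\<in>UNIV. e $ (i, k) $ (k, j))"

lemma op_action_kron: "op_action (kron a b) = kron a (transpose b)"
  by (simp add: op_action_def kron_def transpose_def vec_eq_iff)

lemma mult_map_kron: "mult_map (kron a b) = a ** b"
  by (simp add: mult_map_def kron_def matrix_matrix_mult_def vec_eq_iff)

lemma left_amp_kron:
  assumes "\<And>c x. f (msc c x) = msc c (f x)"
  shows "left_amp f (kron a b) = kron (f a) b"
proof -
  have "(\<chi> i j. kron a b $ (i, snd p) $ (j, snd q)) = msc (b $ snd p $ snd q) a" for p q :: "'a \<times> 'a"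
    by (simp add: kron_def msc_def vec_eq_iff mult.commute)
  then show ?thesis
    by (simp add: left_amp_def assms) (simp add: kron_def msc_def vec_eq_iff mult.commute)
qed

lemma left_amp_add:
  assumes "\<And>x y. f (x + y) = f x + f y"
  shows "left_amp f (e + e') = left_amp f e + left_amp f e'"
proof -
  have "(\<chi> i j. (e + e') $ (i, snd p) $ (j, snd q))
      = (\<chi> i j. e $ (i, snd p) $ (j, snd q)) + (\<chi> i j. e' $ (i, snd p) $ (j, snd q))"
    for p q :: "'a \<times> 'a"
    by (simp add: vec_eq_iff)
  then show ?thesis
    by (simp add: left_amp_def assms) (simp add: vec_eq_iff)
qed

lemma msc_mult_left: "msc c a ** b = msc c (a ** b)"
  by (simp add: msc_def matrix_matrix_mult_def vec_eq_iff sum_distrib_left mult_ac)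

lemma msc_mult_right: "a ** msc c b = msc c (a ** b)"
  by (simp add: msc_def matrix_matrix_mult_def vec_eq_iff sum_distrib_left mult_ac)

lemma sigma_msc: "sigma_aut Q z (msc c a) = msc c (sigma_aut Q z a)"
  by (simp add: sigma_aut_def msc_mult_left msc_mult_right)

lemma matrix_add_rdistrib':
  fixes a b :: "complex ^ 'k ^ 'm" and c :: "complex ^ 'n ^ 'k"
  shows "(a + b) ** c = a ** c + b ** c"
  by (simp add: matrix_matrix_mult_def vec_eq_iff sum.distrib distrib_right)

lemma sum_matrix_mult:
  fixes f :: "'i \<Rightarrow> complex ^ 'k ^ 'm" and g :: "'j \<Rightarrow> complex ^ 'n ^ 'k"
  shows "(\<Sum>i\<in>I. f i) ** (\<Sum>j\<in>J. g j) = (\<Sum>i\<in>I. \<Sum>j\<in>J. f i ** g j)"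
proof -
  have r: "a ** (\<Sum>j\<in>J. g j) = (\<Sum>j\<in>J. a ** g j)" for a :: "complex ^ 'k ^ 'm"
    by (induction J rule: infinite_finite_induct) (simp_all add: matrix_add_ldistrib)
  have "(\<Sum>i\<in>I. f i) ** c = (\<Sum>i\<in>I. f i ** c)" for c :: "complex ^ 'n ^ 'k"
    by (induction I rule: infinite_finite_induct) (simp_all add: matrix_add_rdistrib')
  then have "(\<Sum>i\<in>I. f i) ** (\<Sum>j\<in>J. g j) = (\<Sum>i\<in>I. f i ** (\<Sum>j\<in>J. g j))" .
  then show ?thesis by (simp only: r)
qed

lemma sigma_add: "sigma_aut Q z (a + b) = sigma_aut Q z a + sigma_aut Q z b"
  by (simp add: sigma_aut_def matrix_add_ldistrib matrix_add_rdistrib')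

lemma sigma_sum: "sigma_aut Q z (\<Sum>i\<in>I. f i) = (\<Sum>i\<in>I. sigma_aut Q z (f i))"
proof (induction I rule: infinite_finite_induct)
  case (insert x F)
  then show ?case by (simp add: sigma_add)
qed (simp_all add: sigma_aut_def)

lemma left_amp_sigma_kron: "left_amp (sigma_aut Q z) (kron a b) = kron (sigma_aut Q z a) b"
  by (rule left_amp_kron) (rule sigma_msc)

lemma
  assumes B: "unital_star_subalgebra B" and L: "gns_map B \<psi> \<Lambda>"
  shows gns_inv_in: "gns_inv B \<Lambda> i \<in> B"
    and gns_inv_axis: "\<Lambda> (gns_inv B \<Lambda> i) = axis i 1"
  using L by (auto simp: gns_map_def gns_inv_def bij_betw_def inv_into_into f_inv_into_f)

lemma
  assumes B: "unital_star_subalgebra B" and L: "gns_map B \<psi> \<Lambda>"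
    and F: "finite I" and f: "\<And>i. i \<in> I \<Longrightarrow> f i \<in> B"
  shows gns_sum_in: "(\<Sum>i\<in>I. msc (c i) (f i)) \<in> B"
    and gns_sum: "\<Lambda> (\<Sum>i\<in>I. msc (c i) (f i)) = (\<Sum>i\<in>I. c i *s \<Lambda> (f i))"
proof -
  have 0: "0 = msc 0 (mat 1 :: 'a cmat)" "mat 1 \<in> B"
    using B by (simp_all add: msc_def vec_eq_iff unital_star_subalgebra_def)
  have 01: "0 \<in> B" "\<Lambda> 0 = 0"
    using B L 0 by (metis unital_star_subalgebra_def, metis gns_map_def vector_smult_lzero)
  have "(\<Sum>i\<in>I. msc (c i) (f i)) \<in> B \<and> \<Lambda> (\<Sum>i\<in>I. msc (c i) (f i)) = (\<Sum>i\<in>I. c i *s \<Lambda> (f i))"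
    using F f
  proof (induction I rule: finite_induct)
    case empty
    then show ?case using 01 by simp
  next
    case (insert x F)
    have "msc (c x) (f x) \<in> B" using B insert.prems by (simp add: unital_star_subalgebra_def)
    then show ?case
      using B L insert by (simp add: unital_star_subalgebra_def gns_map_def)
  qed
  then show "(\<Sum>i\<in>I. msc (c i) (f i)) \<in> B"
    "\<Lambda> (\<Sum>i\<in>I. msc (c i) (f i)) = (\<Sum>i\<in>I. c i *s \<Lambda> (f i))" by auto
qed

lemma gns_expand:
  assumes B: "unital_star_subalgebra B" and L: "gns_map B \<psi> \<Lambda>" and a: "a \<in> B"
  shows "a = (\<Sum>i\<in>UNIV. msc (\<Lambda> a $ i) (gns_inv B \<Lambda> i))"
proof -
  have "\<Lambda> (\<Sum>i\<in>UNIV. msc (\<Lambda> a $ i) (gns_inv B \<Lambda> i)) = (\<Sum>i\<in>UNIV. \<Lambda> a $ i *s axis i 1)"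
    using gns_sum[OF B L finite gns_inv_in[OF B L]] by (simp add: gns_inv_axis[OF B L])
  also have "\<dots> = \<Lambda> a" by (rule basis_expansion)
  finally show ?thesis
    using L a gns_sum_in[OF B L finite gns_inv_in[OF B L]]
    unfolding gns_map_def bij_betw_def by (intro inj_onD[of \<Lambda> B a]) simp_all
qed

lemma mult_op_vtens:
  assumes B: "unital_star_subalgebra B" and L: "gns_map B \<psi> \<Lambda>" and ab: "a \<in> B" "b \<in> B"
  shows "mult_op B \<Lambda> *v vtens (\<Lambda> a) (\<Lambda> b) = \<Lambda> (a ** b)"
proof -
  let ?g = "gns_inv B \<Lambda>"
  have "a ** b = (\<Sum>i\<in>UNIV. msc (\<Lambda> a $ i) (?g i)) ** (\<Sum>j\<in>UNIV. msc (\<Lambda> b $ j) (?g j))"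
    by (rule arg_cong2[where f="(**)", OF gns_expand[OF B L ab(1)] gns_expand[OF B L ab(2)]])
  also have "\<dots> = (\<Sum>p\<in>UNIV. msc (\<Lambda> a $ fst p * \<Lambda> b $ snd p) (?g (fst p) ** ?g (snd p)))"
    by (simp add: sum_matrix_mult msc_mult_left msc_mult_right sum.cartesian_product
        case_prod_beta) (simp add: msc_def mult_ac)
  finally have *: "a ** b = (\<Sum>p\<in>UNIV. msc (\<Lambda> a $ fst p * \<Lambda> b $ snd p) (?g (fst p) ** ?g (snd p)))" .
  have "?g i ** ?g j \<in> B" for i j
    using B gns_inv_in[OF B L] by (simp add: unital_star_subalgebra_def)
  then have "\<Lambda> (a ** b) = (\<Sum>p\<in>UNIV. (\<Lambda> a $ fst p * \<Lambda> b $ snd p) *s \<Lambda> (?g (fst p) ** ?g (snd p)))"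
    unfolding * by (intro gns_sum[OF B L]) auto
  then show ?thesis
    by (simp add: vec_eq_iff mult_op_def vtens_def matrix_vector_mult_def sum_component mult_ac)
qed

lemma unit_op_apply: "unit_op \<Lambda> *v c = c $ 1 *s \<Lambda> (mat 1)"
  by (simp add: unit_op_def vec_eq_iff matrix_vector_mult_def sum_component UNIV_1 mult.commute)

lemma Psi_theta:
  assumes B: "unital_star_subalgebra B" and L: "gns_map B \<psi> \<Lambda>" and ab: "a \<in> B" "b \<in> B"
  shows "Psi Q B \<Lambda> (theta (\<Lambda> a) (\<Lambda> b)) = kron (adj a) (sigma_aut Q (\<i> / 2) b)"
proof -
  let ?g = "gns_inv B \<Lambda>"
  have 1: "adj a = (\<Sum>j\<in>UNIV. msc (cnj (\<Lambda> a $ j)) (adj (?g j)))"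
    by (subst gns_expand[OF B L ab(1)]) (simp add: adj_def msc_def vec_eq_iff sum_component)
  have 2: "sigma_aut Q (\<i> / 2) b = (\<Sum>i\<in>UNIV. msc (\<Lambda> b $ i) (sigma_aut Q (\<i> / 2) (?g i)))"
    by (subst gns_expand[OF B L ab(2)]) (simp add: sigma_sum sigma_msc)
  show ?thesis
    unfolding 1 2 Psi_def
    by (subst sum.swap)
      (simp add: vec_eq_iff kron_def msc_def theta_def sum_component sum_product mult_ac)
qed

lemma Psi'_theta:
  assumes B: "unital_star_subalgebra B" and L: "gns_map B \<psi> \<Lambda>" and ab: "a \<in> B" "b \<in> B"
  shows "Psi' Q B \<Lambda> (theta (\<Lambda> a) (\<Lambda> b)) = kron (sigma_aut Q (\<i> / 2) b) (adj a)"
proof -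
  let ?g = "gns_inv B \<Lambda>"
  have 1: "adj a = (\<Sum>j\<in>UNIV. msc (cnj (\<Lambda> a $ j)) (adj (?g j)))"
    by (subst gns_expand[OF B L ab(1)]) (simp add: adj_def msc_def vec_eq_iff sum_component)
  have 2: "sigma_aut Q (\<i> / 2) b = (\<Sum>i\<in>UNIV. msc (\<Lambda> b $ i) (sigma_aut Q (\<i> / 2) (?g i)))"
    by (subst gns_expand[OF B L ab(2)]) (simp add: sigma_sum sigma_msc)
  show ?thesis
    unfolding 1 2 Psi'_def
    by (simp add: vec_eq_iff kron_def msc_def theta_def sum_component sum_product mult_ac)
      (intro allI sum.swap)
qed

end

theory Submission
  imports Defs
begin

text \<open>
  Let \<open>(g\<^sub>j)\<close> be the basis of \<open>B\<close> mapped by \<open>\<Lambda>\<close> to the standard basis and write \<open>A\<close> as a linear map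
  on \<open>B\<close>.  As \<open>m\<^sup>*\<Lambda>(c)\<close> equals both \<open>\<Sum> \<Lambda>(g\<^sub>j) \<otimes> \<Lambda>(g\<^sub>j\<^sup>* c)\<close> and, by traciality,
  \<open>\<Sum> \<Lambda>(c Q g\<^sub>j\<^sup>* Q\<^sup>-\<^sup>1) \<otimes> \<Lambda>(g\<^sub>j)\<close>, the two forms of (1) say \<open>\<Sum> A(g\<^sub>j) g\<^sub>j\<^sup>* = 1\<close> and
  \<open>\<Sum> Q g\<^sub>j\<^sup>* Q\<^sup>-\<^sup>1 A(g\<^sub>j) = 1\<close>.  The condition
  \<open>(1 \<otimes> \<eta>\<^sup>*m)(1 \<otimes> A \<otimes> 1)(m\<^sup>*\<eta> \<otimes> 1) = A\<close> makes both sums equal to \<open>\<Sum> g\<^sub>j A(g\<^sub>j\<^sup>*)\<close>.  On the other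
  hand \<open>u\<^sub>0\<close> and \<open>u\<^sub>1\<close> both correspond to the operator \<open>Q\<^sup>-\<^sup>1\<^sup>/\<^sup>2\<close>, and \<open>e\<close> acts on operators by
  \<open>T \<mapsto> \<Sum> g\<^sub>j\<^sup>* T \<sigma>(A(g\<^sub>j))\<close> or by \<open>T \<mapsto> \<Sum> \<sigma>(A(g\<^sub>j)) T g\<^sub>j\<^sup>*\<close>, with \<open>\<sigma> = \<sigma>\<^sub>i\<^sub>/\<^sub>2\<close>.  This action is
  idempotent because \<open>m(A \<otimes> A)m\<^sup>* = A\<close>, and it fixes \<open>Q\<^sup>-\<^sup>1\<^sup>/\<^sup>2\<close> exactly when one of the two sums is \<open>1\<close>.
\<close>

section \<open>Calculus of the inner product, adjoints and rank-one operators\<close>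

lemma Re_cip: "Re (cip x y) = inner x y"
  by (simp add: cip_def inner_vec_def inner_complex_def)

lemma cip_add_right: "cip x (y + z) = cip x y + cip x z"
  by (simp add: cip_def distrib_left sum.distrib)

lemma cip_add_left: "cip (x + y) z = cip x z + cip y z"
  by (simp add: cip_def distrib_right sum.distrib)

lemma cip_diff_right: "cip x (y - z) = cip x y - cip x z"
  by (simp add: cip_def right_diff_distrib sum_subtractf)

lemma cip_scale_right: "cip x (c *s y) = c * cip x y"
  by (simp add: cip_def sum_distrib_left mult_ac)

lemma cip_scale_left: "cip (c *s x) y = cnj c * cip x y"
  by (simp add: cip_def sum_distrib_left mult_ac)

lemma cip_zero_right [simp]: "cip x 0 = 0"
  by (simp add: cip_def)

lemma cip_zero_left [simp]: "cip 0 x = 0"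
  by (simp add: cip_def)

lemma cip_sum_right: "cip x (\<Sum>i\<in>I. f i) = (\<Sum>i\<in>I. cip x (f i))"
  by (induction I rule: infinite_finite_induct) (simp_all add: cip_add_right)

lemma cip_commute: "cip y x = cnj (cip x y)"
  by (simp add: cip_def mult.commute)

lemma cip_self: "cip x x = of_real ((norm x)\<^sup>2)"
  by (rule complex_eqI)
    (simp_all only: Re_cip Re_complex_of_real Im_complex_of_real power2_norm_eq_inner,
      simp add: cip_def)

lemma cip_self_eq_0: "cip x x = 0 \<longleftrightarrow> x = 0"
  by (simp add: cip_self)

lemma cip_axis_left: "cip (axis i 1) x = x $ i"
proof -
  have "cip (axis i 1) x = (\<Sum>j\<in>UNIV. if j = i then x $ j else 0)"
    unfolding cip_def by (rule sum.cong) (simp_all add: axis_def)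
  then show ?thesis by simp
qed

lemma adj_adj [simp]: "adj (adj M) = M"
  by (simp add: adj_def vec_eq_iff)

lemma adj_mult: "adj (M ** N) = adj N ** adj M"
  by (simp add: adj_def matrix_matrix_mult_def vec_eq_iff mult.commute)

lemma adj_mat_1 [simp]: "adj (mat 1) = mat 1"
  by (simp add: adj_def mat_def vec_eq_iff)

lemma adj_msc: "adj (msc c M) = msc (cnj c) (adj M)"
  by (simp add: adj_def msc_def vec_eq_iff)

lemma adj_sum: "adj (\<Sum>i\<in>I. f i) = (\<Sum>i\<in>I. adj (f i))"
  by (simp add: adj_def vec_eq_iff)

lemma adj_theta: "adj (theta x y) = theta y x"
  by (simp add: adj_def theta_def vec_eq_iff mult.commute)

lemma cip_adj_right: "cip x (adj M *v y) = cip (M *v x) y"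
  using cip_adj[of "adj M" x y] by simp

lemma msc_vector_mult: "msc c M *v x = c *s (M *v x)"
  by (simp add: msc_def matrix_vector_mult_def vec_eq_iff sum_distrib_left mult_ac)

lemma matrix_sum_vector_mult:
  fixes f :: "'i \<Rightarrow> complex ^ 'k ^ 'm"
  shows "(\<Sum>i\<in>I. f i) *v x = (\<Sum>i\<in>I. f i *v x)"
  by (induction I rule: infinite_finite_induct) (simp_all add: matrix_vector_mult_add_rdistrib)

lemma matrix_vector_mult_sum:
  fixes M :: "complex ^ 'k ^ 'm"
  shows "M *v (\<Sum>i\<in>I. f i) = (\<Sum>i\<in>I. M *v f i)"
  by (induction I rule: infinite_finite_induct) (simp_all add: matrix_vector_right_distrib)

lemma matrix_mult_sum:
  fixes M :: "complex ^ 'k ^ 'm"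
  shows "M ** (\<Sum>i\<in>I. f i) = (\<Sum>i\<in>I. M ** f i)"
  by (induction I rule: infinite_finite_induct) (simp_all add: matrix_add_ldistrib)

lemma sum_mult_matrix:
  fixes M :: "complex ^ 'k ^ 'm"
  shows "(\<Sum>i\<in>I. f i) ** M = (\<Sum>i\<in>I. f i ** M)"
  by (induction I rule: infinite_finite_induct) (simp_all add: matrix_add_rdistrib')

lemma matrix_mult_theta: "M ** theta x y = theta x (M *v y)"
  by (simp add: theta_def matrix_matrix_mult_def matrix_vector_mult_def vec_eq_iff
      sum_distrib_right mult.assoc)

lemma theta_mult_matrix: "theta x y ** M = theta (adj M *v x) y"
  by (simp add: theta_def matrix_matrix_mult_def matrix_vector_mult_def vec_eq_iff adj_def
      sum_distrib_left mult.assoc) (simp add: mult.commute)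

lemma theta_scale_right: "theta x (c *s y) = msc c (theta x y)"
  by (simp add: theta_def msc_def vec_eq_iff mult_ac)

lemma msc_msc: "msc c (msc d M) = msc (c * d) M"
  by (simp add: msc_def vec_eq_iff mult_ac)

lemma msc_one [simp]: "msc 1 M = M"
  by (simp add: msc_def vec_eq_iff)

section \<open>The spectral theorem for self-adjoint matrices\<close>

lemma positive_op_self_adjoint:
  assumes "positive_op Q"
  shows "adj Q = Q"
proof -
  \<comment> \<open>The quadratic form of \<open>D\<close> vanishes because that of \<open>Q\<close>
    is real; polarization over the complex numbers then forces \<open>D = 0\<close>.\<close>
  define D where "D = Q - adj Q"
  have D0: "cip x (D *v x) = 0" for x
  proof -
    have r: "cip x (Q *v x) \<in> \<real>"
      using assms nonneg_Reals_subset_Reals by (auto simp: positive_op_def)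
    have "cip x (adj Q *v x) = cnj (cip x (Q *v x))"
      by (simp add: cip_adj_right cip_commute[of x])
    then show ?thesis
      using r by (simp add: D_def matrix_vector_mult_diff_rdistrib cip_diff_right Reals_cnj_iff)
  qed
  have "cip x (D *v y) = 0" for x y
  proof -
    have 1: "cip x (D *v y) + cip y (D *v x) = 0"
      using D0[of "x + y"] D0[of x] D0[of y]
      by (simp add: matrix_vector_right_distrib cip_add_left cip_add_right add.commute)
    \<comment> \<open>Testing at \<open>x + y\<close> gave the sum of the two mixed terms; testing
      at \<open>x + \<i> *s y\<close> gives their difference.\<close>
    have "\<i> * cip x (D *v y) - \<i> * cip y (D *v x) = 0"
      using D0[of "x + \<i> *s y"] D0[of x] D0[of y]
      by (simp add: matrix_vector_right_distrib cip_add_left cip_add_right vec.scale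
          cip_scale_left cip_scale_right)
    then have "cip x (D *v y) = cip y (D *v x)" by simp
    with 1 show ?thesis by simp
  qed
  then have "D *v y = 0" for y by (metis cip_self_eq_0)
  then have "Q *v y = adj Q *v y" for y
    by (simp add: D_def matrix_vector_mult_diff_rdistrib)
  then show ?thesis by (simp add: matrix_eq)
qed

text \<open>The eigenvector is a maximiser of the Rayleigh quotient on the orthogonal complement of
  \<open>E\<close>.\<close>

lemma eigenvector_in_complement:
  fixes Q :: "'n::finite cmat"
  assumes Q: "adj Q = Q" and E: "\<And>v. v \<in> E \<Longrightarrow> \<exists>l. Q *v v = l *s v"
    and x0: "x0 \<noteq> 0" "\<And>v. v \<in> E \<Longrightarrow> cip v x0 = 0"
  shows "\<exists>x l. norm x = 1 \<and> (\<forall>v\<in>E. cip v x = 0) \<and> Q *v x = l *s x"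
proof -
  define W where "W = {x. \<forall>v\<in>E. cip v x = 0}"
  define K where "K = {x \<in> W. norm x = 1}"
  define r where "r = (\<lambda>x. Re (cip x (Q *v x)))"
  have W_add: "x + y \<in> W" if "x \<in> W" "y \<in> W" for x y
    using that by (simp add: W_def cip_add_right)
  have W_scale: "c *s x \<in> W" if "x \<in> W" for x c
    using that by (simp add: W_def cip_scale_right)
  \<comment> \<open>Self-adjointness moves \<open>Q\<close> onto the eigenvector \<open>v\<close>,
    so the complement \<open>W\<close> is invariant.\<close>
  have W_Q: "Q *v x \<in> W" if x: "x \<in> W" for x
  proof -
    have "cip v (Q *v x) = 0" if v: "v \<in> E" for v
    proof -
      obtain l where "Q *v v = l *s v" using E[OF v] by blast
      then have "cip v (Q *v x) = cnj l * cip v x"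
        using cip_adj_right[of v Q x] by (simp add: Q cip_scale_left)
      then show ?thesis using x v by (simp add: W_def)
    qed
    then show ?thesis by (simp add: W_def)
  qed
  have norm_scale: "norm (complex_of_real c *s x) = \<bar>c\<bar> * norm x" for c and x :: "complex ^ 'n"
  proof -
    have "complex_of_real c *s x = c *\<^sub>R x"
      by (simp add: vec_eq_iff scaleR_conv_of_real[where 'a=complex])
    then show ?thesis by simp
  qed
  have cont: "continuous_on UNIV (\<lambda>x. cip v x)" for v :: "complex ^ 'n"
    unfolding cip_def by (intro continuous_intros)
  have "closed W"
  proof -
    have "W = (\<Inter>v\<in>E. {x. cip v x = 0})" by (auto simp: W_def)
    also have "closed \<dots>"
      by (intro closed_INT ballI closed_Collect_eq cont continuous_intros)
    finally show ?thesis .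
  qed
  moreover have "K = W \<inter> sphere 0 1" by (auto simp: K_def)
  ultimately have "compact K" by (auto intro: closed_Int_compact)
  moreover have "K \<noteq> {}"
  proof -
    have "of_real (1 / norm x0) *s x0 \<in> K"
      using x0 W_scale[of x0] unfolding K_def
      by (simp add: W_def norm_scale del: of_real_divide)
    then show ?thesis by blast
  qed
  moreover have "continuous_on K r"
    unfolding r_def cip_def matrix_vector_mult_def by (intro continuous_intros)
  ultimately obtain x where x: "x \<in> K" and max: "\<And>y. y \<in> K \<Longrightarrow> r y \<le> r x"
    by (meson continuous_attains_sup)
  have xW: "x \<in> W" and x1: "norm x = 1" using x by (auto simp: K_def)
  \<comment> \<open>Maximality of \<open>r x\<close> on the unit sphere of \<open>W\<close>,
    extended by scaling, makes \<open>P\<close> positive on \<open>W\<close>. Its quadratic form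
    vanishes at \<open>x\<close>, and the goal is \<open>P x = 0\<close>.\<close>
  define P where "P = (\<lambda>y. of_real (r x) *s y - Q *v y)"
  have P_add: "P (y + z) = P y + P z" for y z
    by (simp add: P_def matrix_vector_right_distrib vector_add_ldistrib)
  have P_scale: "P (c *s y) = c *s P y" for c y
    by (simp add: P_def vec.scale vector_ssub_ldistrib mult_ac)
  have P_sym: "cip y (P z) = cip (P y) z" for y z
    using cip_adj_right[of y Q z]
    by (simp add: P_def Q cip_diff_right cip_scale_right)
      (simp add: cip_def algebra_simps sum_distrib_left sum_subtractf)
  have P_pos: "0 \<le> Re (cip y (P y))" if "y \<in> W" for y
  proof (cases "y = 0")
    case False
    define t where "t = 1 / norm y"
    have "complex_of_real t *s y \<in> K"
      using W_scale[OF that, of "of_real t"] False by (simp add: K_def t_def norm_scale del: of_real_divide)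
    then have "r (complex_of_real t *s y) \<le> r x" by (rule max)
    then have "t\<^sup>2 * r y \<le> r x"
      by (simp add: r_def vec.scale cip_scale_left cip_scale_right power2_eq_square mult_ac)
    then have "(norm y)\<^sup>2 * (t\<^sup>2 * r y) \<le> (norm y)\<^sup>2 * r x" by (rule mult_left_mono) simp
    then have "r y \<le> r x * (norm y)\<^sup>2"
      using False by (simp add: t_def power_divide mult.commute)
    then show ?thesis
      by (simp add: P_def cip_diff_right cip_scale_right cip_self r_def del: of_real_power)
  qed simp
  define y where "y = P x"
  have yW: "y \<in> W"
    using W_add[OF W_scale[OF xW, of "of_real (r x)"] W_scale[OF W_Q[OF xW], of "-1"]]
    by (simp add: y_def P_def)
  define a b where "a = (norm y)\<^sup>2" and "b = Re (cip y (P y))"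
  have xPx: "Re (cip x (P x)) = 0"
    by (simp add: P_def cip_diff_right cip_scale_right cip_self x1 r_def)
  \<comment> \<open>Variation of \<open>x\<close> in the direction \<open>y = P x\<close>: the
    linear coefficient is twice the squared norm of \<open>P x\<close>.\<close>
  have quad: "0 \<le> 2 * t * a + t\<^sup>2 * b" for t
  proof -
    have "0 \<le> Re (cip (x + of_real t *s y) (P (x + of_real t *s y)))"
      by (intro P_pos W_add W_scale xW yW)
    also have "\<dots> = Re (cip x (P x)) + t * Re (cip (P x) y) + t * Re (cip y (P x)) + t\<^sup>2 * b"
      by (simp add: P_add P_scale cip_add_left cip_add_right cip_scale_left cip_scale_right
          b_def power2_eq_square P_sym[of x y] distrib_left)
    also have "\<dots> = 2 * t * a + t\<^sup>2 * b"
      using xPx by (simp add: cip_self a_def flip: y_def del: of_real_power)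
    finally show ?thesis .
  qed
  have "b \<ge> 0" using P_pos[OF yW] by (simp add: b_def)
  have "a = 0"
  proof (rule ccontr)
    assume "a \<noteq> 0"
    then have "a > 0" by (simp add: a_def)
    \<comment> \<open>The minimiser would be \<open>- a / b\<close>; the denominator
      \<open>b + 1\<close> still gives a negative value and also covers
      \<open>b = 0\<close>.\<close>
    have "2 * (- a / (b + 1)) * a + (- a / (b + 1))\<^sup>2 * b = - (a\<^sup>2 * (b + 2)) / (b + 1)\<^sup>2"
      using \<open>b \<ge> 0\<close> by (simp add: divide_simps power2_eq_square) (simp add: algebra_simps)
    also have "\<dots> < 0"
      using \<open>a > 0\<close> \<open>b \<ge> 0\<close> by (auto intro!: divide_neg_pos mult_pos_pos)
    finally show False using quad[of "- a / (b + 1)"] by linarith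
  qed
  then have "Q *v x = of_real (r x) *s x" by (simp add: a_def y_def P_def)
  with x1 xW show ?thesis unfolding W_def by blast
qed

definition orthonormal_set :: "(complex ^ 'n) set \<Rightarrow> bool" where
  "orthonormal_set E \<longleftrightarrow> (\<forall>v\<in>E. \<forall>w\<in>E. cip v w = (if v = w then 1 else 0))"

text \<open>By \<open>Re_cip\<close> such a set is orthogonal for the real inner product, hence
  independent over the reals. The bound is the real dimension, which suffices to pick a set of
  greatest cardinality.\<close>

lemma orthonormal_set_finite_card:
  fixes E :: "(complex ^ 'n::finite) set"
  assumes "orthonormal_set E"
  shows "finite E \<and> card E \<le> DIM(complex ^ 'n)"
proof -
  have "pairwise orthogonal E"
    using assms by (auto simp: pairwise_def orthogonal_def orthonormal_set_def simp flip: Re_cip)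
  moreover have "0 \<notin> E"
    using assms unfolding orthonormal_set_def by (metis cip_zero_left zero_neq_one)
  ultimately have "independent E" by (rule pairwise_orthogonal_independent)
  then show ?thesis by (rule independent_bound)
qed

text \<open>Subtracting from \<open>x\<close> its projection leaves a vector orthogonal to every
  \<open>b j\<close>, which completeness makes zero. It serves both for eigenvectors and for a given
  orthonormal basis.\<close>

lemma orthonormal_complete_sum:
  fixes b :: "'j \<Rightarrow> complex ^ 'n::finite"
  assumes "finite J" and on: "\<And>i j. i \<in> J \<Longrightarrow> j \<in> J \<Longrightarrow> cip (b i) (b j) = (if i = j then 1 else 0)"
    and complete: "\<And>x. (\<And>j. j \<in> J \<Longrightarrow> cip (b j) x = 0) \<Longrightarrow> x = 0"
  shows "(\<Sum>j\<in>J. theta (b j) (b j)) = mat 1"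
proof -
  have "(\<Sum>j\<in>J. theta (b j) (b j)) *v x = x" for x
  proof -
    define y where "y = x - (\<Sum>j\<in>J. cip (b j) x *s b j)"
    have "cip (b i) y = 0" if "i \<in> J" for i
    proof -
      have "(\<Sum>j\<in>J. cip (b j) x * cip (b i) (b j)) = (\<Sum>j\<in>J. if i = j then cip (b j) x else 0)"
        by (rule sum.cong) (simp_all add: on that)
      then show ?thesis
        using that \<open>finite J\<close> by (simp add: y_def cip_diff_right cip_sum_right cip_scale_right)
    qed
    then have "y = 0" by (rule complete)
    then show ?thesis by (simp add: y_def matrix_sum_vector_mult theta_apply)
  qed
  then show ?thesis by (simp add: matrix_eq)
qed

text \<open>An orthonormal set of eigenvectors of greatest cardinality is complete: a nonzero vector
  orthogonal to it would, by \<open>eigenvector_in_complement\<close>, provide one more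
  eigenvector.\<close>

theorem spectral_theorem:
  fixes Q :: "'n::finite cmat"
  assumes Q: "adj Q = Q"
  obtains E \<mu> where "finite E" "orthonormal_set E" "\<And>v. v \<in> E \<Longrightarrow> Q *v v = \<mu> v *s v"
    "(\<Sum>v\<in>E. theta v v) = mat 1"
proof -
  define good where "good E \<longleftrightarrow> orthonormal_set E \<and> (\<forall>v\<in>E. \<exists>l. Q *v v = l *s v)"
    for E :: "(complex ^ 'n) set"
  have "good {}" by (simp add: good_def orthonormal_set_def)
  moreover have "card E < Suc (DIM(complex ^ 'n))" if "good E" for E
    using orthonormal_set_finite_card[of E] that by (simp add: good_def)
  ultimately obtain E where E: "good E" and max: "\<And>F. good F \<Longrightarrow> card F \<le> card E"
    using ex_has_greatest_nat[of good "{}" card "Suc (DIM(complex ^ 'n))"]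
    by (meson less_imp_le_nat)
  have on: "orthonormal_set E" and fin: "finite E"
    using E orthonormal_set_finite_card by (auto simp: good_def)
  obtain \<mu> where \<mu>: "\<And>v. v \<in> E \<Longrightarrow> Q *v v = \<mu> v *s v"
    using E unfolding good_def by metis
  have complete: "x0 = 0" if x0: "\<And>v. v \<in> E \<Longrightarrow> cip v x0 = 0" for x0
  proof (rule ccontr)
    assume "x0 \<noteq> 0"
    then obtain x l where x: "norm x = 1" "\<And>v. v \<in> E \<Longrightarrow> cip v x = 0" "Q *v x = l *s x"
      using eigenvector_in_complement[OF Q _ _ x0, of E] \<mu> by blast
    have "cip x x = 1" by (simp add: cip_self x)
    then have "x \<notin> E" using x(2) by fastforce
    moreover have "cip x v = 0" if "v \<in> E" for v
      using x(2)[OF that] cip_commute[of x v] by simp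
    ultimately have "good (insert x E)"
      using x(2,3) E \<open>cip x x = 1\<close> by (auto simp: good_def orthonormal_set_def)
    from max[OF this] show False using fin \<open>x \<notin> E\<close> by simp
  qed
  have "(\<Sum>v\<in>E. theta v v) = mat 1"
    using fin on complete by (intro orthonormal_complete_sum) (auto simp: orthonormal_set_def)
  with that fin on \<mu> show thesis by blast
qed

section \<open>Complex powers of a positive invertible matrix\<close>

text \<open>The definite description in \<open>mpow\<close> is met by exactly one matrix, the
  diagonal one. Since \<open>E\<close> and \<open>\<mu>\<close> do not depend on \<open>z\<close>,
  the power laws reduce to those of positive numbers.\<close>

lemma mpow_spectral:
  fixes Q :: "'n::finite cmat"
  assumes Q: "positive_op Q" "invertible Q"
  shows "\<exists>E \<mu>. finite E \<and> orthonormal_set E \<and> (\<forall>v\<in>E. Q *v v = of_real (\<mu> v) *s v) \<and>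
    (\<Sum>v\<in>E. theta v v) = mat 1 \<and> (\<forall>v\<in>E. \<mu> v > 0) \<and>
    (\<forall>z. mpow Q z = (\<Sum>v\<in>E. msc (of_real (\<mu> v) powr z) (theta v v)))"
proof -
  note sa = positive_op_self_adjoint[OF Q(1)]
  obtain E \<nu> where fin: "finite E" and on: "orthonormal_set E"
    and \<nu>: "\<And>v. v \<in> E \<Longrightarrow> Q *v v = \<nu> v *s v" and 1: "(\<Sum>v\<in>E. theta v v) = mat 1"
    using spectral_theorem[OF sa] by metis
  have pos: "\<nu> v = of_real (Re (\<nu> v)) \<and> Re (\<nu> v) > 0" if "v \<in> E" for v
  proof -
    have vv: "cip v v = 1" using on that by (simp add: orthonormal_set_def)
    have "cip v (Q *v v) = \<nu> v" using that by (simp add: \<nu> cip_scale_right vv)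
    then have "\<nu> v \<in> \<real>\<^sub>\<ge>\<^sub>0" using Q(1) by (metis positive_op_def)
    moreover have "\<nu> v \<noteq> 0"
    proof
      assume "\<nu> v = 0"
      then have "Q *v v = Q *v 0" using \<nu>[OF that] by simp
      then have "v = 0" using Q(2) by (metis invertible_def matrix_vector_mul_assoc matrix_vector_mul_lid)
      then show False using vv by simp
    qed
    ultimately show ?thesis
      by (auto simp: complex_nonneg_Reals_iff complex_eq_iff)
  qed
  have mp: "mpow Q z = (\<Sum>v\<in>E. msc (\<nu> v powr z) (theta v v))" for z
    unfolding mpow_def
  proof (rule the_equality, intro allI impI)
    fix l w
    assume lw: "Q *v w = l *s w"
    \<comment> \<open>Eigenvectors for different eigenvalues are orthogonal: either
      \<open>\<nu> v = l\<close> or \<open>cip v w = 0\<close>.\<close>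
    have "(\<nu> v powr z * cip v w) *s v = (l powr z * cip v w) *s v" if "v \<in> E" for v
    proof -
      have "l * cip v w = cip v (Q *v w)" by (simp add: lw cip_scale_right)
      also have "\<dots> = cnj (\<nu> v) * cip v w"
        using cip_adj_right[of v Q w] that by (simp add: sa \<nu> cip_scale_left)
      also have "cnj (\<nu> v) = \<nu> v" by (metis pos[OF that] complex_cnj_complex_of_real)
      finally show ?thesis by auto
    qed
    then have "(\<Sum>v\<in>E. msc (\<nu> v powr z) (theta v v)) *v w = (\<Sum>v\<in>E. (l powr z * cip v w) *s v)"
      by (auto simp: matrix_sum_vector_mult msc_vector_mult theta_apply intro!: sum.cong)
    also have "\<dots> = l powr z *s ((\<Sum>v\<in>E. theta v v) *v w)"
      by (simp add: matrix_sum_vector_mult theta_apply vec.scale_sum_right)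
    finally show "(\<Sum>v\<in>E. msc (\<nu> v powr z) (theta v v)) *v w = l powr z *s w" by (simp add: 1)
  next
    fix X
    assume X: "\<forall>l v. Q *v v = l *s v \<longrightarrow> X *v v = l powr z *s v"
    \<comment> \<open>Uniqueness: \<open>X\<close> is prescribed on the eigenvectors in
      \<open>E\<close>, and these resolve the identity.\<close>
    have "X = X ** (\<Sum>v\<in>E. theta v v)" by (simp add: 1)
    also have "\<dots> = (\<Sum>v\<in>E. msc (\<nu> v powr z) (theta v v))"
      unfolding matrix_mult_sum
      by (rule sum.cong) (simp_all add: matrix_mult_theta X[rule_format, OF \<nu>] theta_scale_right)
    finally show "X = (\<Sum>v\<in>E. msc (\<nu> v powr z) (theta v v))" .
  qed
  have "mpow Q z = (\<Sum>v\<in>E. msc (of_real (Re (\<nu> v)) powr z) (theta v v))" for z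
    unfolding mp using pos by (intro sum.cong) auto
  then show ?thesis
    using fin on 1 pos \<nu> by (intro exI[of _ E] exI[of _ "\<lambda>v. Re (\<nu> v)"]) auto
qed

context
  fixes Q :: "'n::finite cmat"
  assumes Q: "positive_op Q" "invertible Q"
begin

lemma mpow_add: "mpow Q (z + w) = mpow Q z ** mpow Q w"
proof -
  obtain E \<mu> where fin: "finite E"
    and on: "orthonormal_set E"
    and \<mu>: "\<forall>v\<in>E. \<mu> v > 0"
    and mp: "\<forall>z. mpow Q z = (\<Sum>v\<in>E. msc (of_real (\<mu> v) powr z) (theta v v))"
    using mpow_spectral[OF Q] by blast
  have "mpow Q z ** mpow Q w = (\<Sum>v\<in>E. \<Sum>u\<in>E.
      if v = u then msc (of_real (\<mu> v) powr (z + w)) (theta v v) else 0)"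
    unfolding mp[rule_format] sum_matrix_mult
  proof (intro sum.cong refl)
    fix v u assume vu: "v \<in> E" "u \<in> E"
    have "theta v v ** theta u u = (if v = u then theta v v else 0)"
      using on vu by (simp add: matrix_mult_theta theta_apply orthonormal_set_def)
        (simp add: theta_def vec_eq_iff)
    then show "msc (of_real (\<mu> v) powr z) (theta v v) ** msc (of_real (\<mu> u) powr w) (theta u u)
      = (if v = u then msc (of_real (\<mu> v) powr (z + w)) (theta v v) else 0)"
      using \<mu> vu(1)
      by (simp add: msc_mult_left msc_mult_right msc_msc powr_add) (simp add: msc_def vec_eq_iff)
  qed
  then show ?thesis using fin by (simp add: mp)
qed

lemma mpow_0: "mpow Q 0 = mat 1"
proof -
  obtain E \<mu> where 1: "(\<Sum>v\<in>E. theta v v) = mat 1"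
    and \<mu>: "\<forall>v\<in>E. \<mu> v > 0"
    and mp: "\<forall>z. mpow Q z = (\<Sum>v\<in>E. msc (of_real (\<mu> v) powr z) (theta v v))"
    using mpow_spectral[OF Q] by blast
  \<comment> \<open>Positivity of the eigenvalues matters here, because \<open>0 powr 0\<close> is
    0.\<close>
  show ?thesis unfolding mp[rule_format] 1[symmetric] using \<mu> by (intro sum.cong) fastforce+
qed

lemma mpow_1: "mpow Q 1 = Q"
proof -
  obtain E \<mu> where ev: "\<forall>v\<in>E. Q *v v = of_real (\<mu> v) *s v"
    and 1: "(\<Sum>v\<in>E. theta v v) = mat 1"
    and mp: "\<forall>z. mpow Q z = (\<Sum>v\<in>E. msc (of_real (\<mu> v) powr z) (theta v v))"
    using mpow_spectral[OF Q] by blast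
  have "Q = Q ** (\<Sum>v\<in>E. theta v v)" by (simp add: 1)
  also have "\<dots> = mpow Q 1"
    unfolding mp[rule_format] matrix_mult_sum
    by (rule sum.cong) (simp_all add: matrix_mult_theta ev theta_scale_right)
  finally show ?thesis by simp
qed

text \<open>The eigenvalues are positive, hence off the branch cut of the logarithm, so conjugating
  a power conjugates only its exponent.\<close>

lemma adj_mpow: "adj (mpow Q z) = mpow Q (cnj z)"
proof -
  obtain E \<mu> where \<mu>: "\<forall>v\<in>E. \<mu> v > 0"
    and mp: "\<forall>z. mpow Q z = (\<Sum>v\<in>E. msc (of_real (\<mu> v) powr z) (theta v v))"
    using mpow_spectral[OF Q] by blast
  show ?thesis unfolding mp[rule_format] adj_sum using \<mu>
    by (intro sum.cong) (auto simp: adj_msc adj_theta cnj_powr)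
qed

end

text \<open>Blockwise, the trace of a product is a double sum that is symmetric in the two
  factors.\<close>

lemma block_trace_commute:
  assumes "is_block_trace B Tr" "x \<in> B" "y \<in> B"
  shows "Tr (x ** y) = Tr (y ** x)"
proof -
  obtain k n \<phi> where iso: "block_iso k n B \<phi>"
    and Tr: "\<And>x. x \<in> multimatrix k n \<Longrightarrow> Tr (\<phi> x) = (\<Sum>i<k. \<Sum>r<n i. x i r r)"
    using assms(1) unfolding is_block_trace_def by blast
  have "B = \<phi> ` multimatrix k n" using iso by (simp add: block_iso_def bij_betw_def)
  then obtain x' y' where x': "x' \<in> multimatrix k n" "x = \<phi> x'"
    and y': "y' \<in> multimatrix k n" "y = \<phi> y'"
    using assms(2,3) by blast
  have *: "Tr (\<phi> u ** \<phi> v) = (\<Sum>i<k. \<Sum>r<n i. \<Sum>t<n i. u i r t * v i t r)"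
    if u: "u \<in> multimatrix k n" and v: "v \<in> multimatrix k n" for u v
  proof -
    define w where "w = (\<lambda>i r s. \<Sum>t<n i. u i r t * v i t s)"
    \<comment> \<open>The trace formula is available only on \<open>multimatrix\<close>, so the
      product must vanish outside the blocks.\<close>
    have "w \<in> multimatrix k n"
      unfolding multimatrix_def
    proof (intro CollectI allI impI)
      fix i r s
      assume "w i r s \<noteq> 0"
      then obtain t where "u i r t * v i t s \<noteq> 0"
        unfolding w_def by (meson sum.neutral)
      then show "i < k \<and> r < n i \<and> s < n i"
        using u v by (auto simp: multimatrix_def)
    qed
    moreover have "\<phi> w = \<phi> u ** \<phi> v"
      using iso u v by (simp add: block_iso_def w_def)
    ultimately show ?thesis using Tr[of w] by (simp add: w_def)
  qed
  show ?thesis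
    unfolding x' y' *[OF x'(1) y'(1)] *[OF y'(1) x'(1)]
    by (subst sum.swap) (simp add: mult.commute)
qed

lemma star_subalgebraD:
  assumes "unital_star_subalgebra B"
  shows "mat 1 \<in> B" "a \<in> B \<Longrightarrow> b \<in> B \<Longrightarrow> a ** b \<in> B"
    "a \<in> B \<Longrightarrow> msc c a \<in> B" "a \<in> B \<Longrightarrow> adj a \<in> B"
  using assms by (auto simp: unital_star_subalgebra_def)

lemma vtens_component: "vtens x y $ (i, j) = x $ i * y $ j"
  by (simp add: vtens_def)

section \<open>The basis of \<open>B\<close> given by the GNS map, and the adjoint of the
  multiplication\<close>

locale gns_algebra =
  fixes B :: "'n::finite cmat set" and \<psi> :: "'n cmat \<Rightarrow> complex"
    and \<Lambda> :: "'n cmat \<Rightarrow> complex ^ 'd::finite"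
  assumes alg: "unital_star_subalgebra B" and gns: "gns_map B \<psi> \<Lambda>"
begin

abbreviation "g \<equiv> gns_inv B \<Lambda>"
abbreviation "m \<equiv> mult_op B \<Lambda>"

lemmas B_one [simp] = star_subalgebraD(1)[OF alg]
  and B_mult [simp] = star_subalgebraD(2)[OF alg]
  and B_msc [simp] = star_subalgebraD(3)[OF alg]
  and B_adj [simp] = star_subalgebraD(4)[OF alg]
  and g_in [simp] = gns_inv_in[OF alg gns]
  and Lambda_g [simp] = gns_inv_axis[OF alg gns]

lemma Lambda_inj: "x \<in> B \<Longrightarrow> y \<in> B \<Longrightarrow> \<Lambda> x = \<Lambda> y \<longleftrightarrow> x = y"
  using gns by (meson gns_map_def bij_betw_def inj_on_eq_iff)

lemma Lambda_surj: obtains x where "x \<in> B" "v = \<Lambda> x"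
  using gns unfolding gns_map_def bij_betw_def by (metis UNIV_I imageE)

lemma cip_Lambda: "x \<in> B \<Longrightarrow> y \<in> B \<Longrightarrow> cip (\<Lambda> x) (\<Lambda> y) = \<psi> (adj x ** y)"
  using gns by (simp add: gns_map_def)

lemma B_sum [simp]: "(\<And>i. i \<in> I \<Longrightarrow> f i \<in> B) \<Longrightarrow> finite I \<Longrightarrow> (\<Sum>i\<in>I. f i) \<in> B"
  using gns_sum_in[OF alg gns, of I f "\<lambda>_. 1"] by simp

lemma Lambda_sum: "(\<And>i. i \<in> I \<Longrightarrow> f i \<in> B) \<Longrightarrow> finite I \<Longrightarrow> \<Lambda> (\<Sum>i\<in>I. f i) = (\<Sum>i\<in>I. \<Lambda> (f i))"
  using gns_sum[OF alg gns, of I f "\<lambda>_. 1"] by simp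

lemma matrix_eq_Lambda: "M = N \<longleftrightarrow> (\<forall>c\<in>B. M *v \<Lambda> c = N *v \<Lambda> c)"
  unfolding matrix_eq by (metis Lambda_surj)

lemma Lambda_nth: "x \<in> B \<Longrightarrow> \<Lambda> x $ i = \<psi> (adj (g i) ** x)"
  by (simp add: cip_axis_left flip: cip_Lambda)

lemma expand: "x \<in> B \<Longrightarrow> (\<Sum>i\<in>UNIV. msc (\<psi> (adj (g i) ** x)) (g i)) = x"
  using gns_expand[OF alg gns, of x] by (simp add: Lambda_nth)

text \<open>This is the adjoint of the expansion of \<open>adj x\<close>. The conjugation symmetry
  of \<open>\<psi>\<close> on these products is that of \<open>cip\<close>.\<close>

lemma expand_adj:
  assumes "x \<in> B"
  shows "(\<Sum>i\<in>UNIV. msc (\<psi> (x ** g i)) (adj (g i))) = x"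
proof -
  have "\<psi> (x ** g i) = cnj (\<psi> (adj (g i) ** adj x))" for i
    using cip_Lambda[of "adj x" "g i"] cip_Lambda[of "g i" "adj x"] assms
      cip_commute[of "\<Lambda> (adj x)" "\<Lambda> (g i)"] by simp
  then have "(\<Sum>i\<in>UNIV. msc (\<psi> (x ** g i)) (adj (g i)))
      = adj (\<Sum>i\<in>UNIV. msc (\<psi> (adj (g i) ** adj x)) (g i))"
    by (simp add: adj_sum adj_msc)
  then show ?thesis using assms by (simp add: expand)
qed

lemma mult_op_Lambda [simp]:
  "x \<in> B \<Longrightarrow> y \<in> B \<Longrightarrow> m *v vtens (\<Lambda> x) (\<Lambda> y) = \<Lambda> (x ** y)"
  by (rule mult_op_vtens[OF alg gns])

text \<open>These coefficients are what both sum formulas for \<open>adj m\<close> are checked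
  against.\<close>

lemma adj_mult_op_nth:
  assumes "c \<in> B"
  shows "(adj m *v \<Lambda> c) $ (i, k) = \<psi> (adj (g k) ** adj (g i) ** c)"
proof -
  have ax: "axis (i, k) 1 = vtens (\<Lambda> (g i)) (\<Lambda> (g k))"
    by (auto simp: vec_eq_iff vtens_def axis_def)
  have "(adj m *v \<Lambda> c) $ (i, k) = cip (m *v axis (i, k) 1) (\<Lambda> c)"
    by (simp add: cip_axis_left flip: cip_adj_right)
  also have "\<dots> = cip (\<Lambda> (g i ** g k)) (\<Lambda> c)"
    unfolding ax by (subst mult_op_Lambda) simp_all
  finally show ?thesis using assms by (simp add: cip_Lambda adj_mult)
qed

lemma axis_sum_nth: "(\<Sum>j\<in>UNIV. (axis j 1 $ i :: complex) * f j) = f i"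
proof -
  have "(\<Sum>j\<in>UNIV. (axis j 1 $ i :: complex) * f j) = (\<Sum>j\<in>UNIV. if j = i then f j else 0)"
    by (rule sum.cong) (auto simp: axis_def)
  then show ?thesis by simp
qed

text \<open>The coefficient at \<open>(i, k)\<close> is read as the coefficient of
  \<open>adj (g i) ** c\<close> at \<open>g k\<close>.\<close>

lemma adj_mult_op_left:
  assumes "c \<in> B"
  shows "adj m *v \<Lambda> c = (\<Sum>i\<in>UNIV. vtens (\<Lambda> (g i)) (\<Lambda> (adj (g i) ** c)))"
proof -
  have "(\<Sum>j\<in>UNIV. vtens (\<Lambda> (g j)) (\<Lambda> (adj (g j) ** c))) $ (i, k) = (adj m *v \<Lambda> c) $ (i, k)" for i k
    using assms
    by (simp add: sum_component vtens_component axis_sum_nth adj_mult_op_nth Lambda_nth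
        matrix_mul_assoc)
  then show ?thesis by (simp add: vec_eq_iff)
qed

end

section \<open>Traciality and the modular relation of \<open>\<psi>\<close>\<close>

locale gns_trace = gns_algebra B \<psi> \<Lambda>
  for B :: "'n::finite cmat set" and \<psi> and \<Lambda> :: "'n cmat \<Rightarrow> complex ^ 'd::finite" +
  fixes Tr :: "'n cmat \<Rightarrow> complex" and Q Qi :: "'n cmat"
  assumes tr: "\<And>x y. x \<in> B \<Longrightarrow> y \<in> B \<Longrightarrow> Tr (x ** y) = Tr (y ** x)"
    and \<psi>_Tr: "\<And>a. a \<in> B \<Longrightarrow> \<psi> a = Tr (Q ** a)"
    and Q_in [simp]: "Q \<in> B" and Qi: "Q ** Qi = mat 1" "Qi ** Q = mat 1"
begin

text \<open>Left multiplication by \<open>Q\<close> is injective on the finite-dimensional space \<open>B\<close>, hence hits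
  the identity.\<close>

lemma Qi_in [simp]: "Qi \<in> B"
proof -
  \<comment> \<open>Left multiplication by \<open>Q\<close>, transported to the coordinate space by
    \<open>\<Lambda>\<close>.\<close>
  define M :: "'d cmat" where "M = m ** (\<chi> p j. vtens (\<Lambda> Q) (axis j 1) $ p)"
  have "(\<chi> p j. vtens (\<Lambda> Q) (axis j 1) $ p) *v v = vtens (\<Lambda> Q) v" for v :: "complex ^ 'd"
  proof -
    have "(\<Sum>j\<in>UNIV. axis j 1 $ k * v $ j) = v $ k" for k
      by (rule axis_sum_nth)
    then show ?thesis
      by (simp add: vec_eq_iff matrix_vector_mult_def vtens_def mult.assoc flip: sum_distrib_left)
  qed
  then have M: "M *v \<Lambda> a = \<Lambda> (Q ** a)" if "a \<in> B" for a
    using that by (simp add: M_def flip: matrix_vector_mul_assoc)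
  have "inj ((*v) M)"
  proof (rule injI)
    fix v w
    assume vw: "M *v v = M *v w"
    obtain x y where xy: "x \<in> B" "y \<in> B" "v = \<Lambda> x" "w = \<Lambda> y" by (metis Lambda_surj)
    then have "Q ** x = Q ** y" using vw by (simp add: M Lambda_inj)
    then have "Qi ** Q ** x = Qi ** Q ** y" by (simp flip: matrix_mul_assoc)
    then show "v = w" by (simp add: Qi xy)
  qed
  then have "surj ((*v) M)"
    using vec.linear_inj_imp_surj matrix_vector_mul_linear_gen by blast
  then obtain v where "M *v v = \<Lambda> (mat 1)" by (metis surjD)
  moreover obtain x where x: "x \<in> B" "v = \<Lambda> x" by (metis Lambda_surj)
  ultimately have "Q ** x = mat 1" by (simp add: M Lambda_inj)
  \<comment> \<open>A right inverse of \<open>Q\<close> found inside \<open>B\<close> must coincide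
    with \<open>Qi\<close>.\<close>
  then have "Qi ** Q ** x = Qi" by (simp flip: matrix_mul_assoc)
  then show ?thesis using x by (simp add: Qi)
qed

lemma Qi_cancel [simp]:
  "x ** Q ** Qi = x" "x ** Qi ** Q = x"
  by (simp_all add: Qi flip: matrix_mul_assoc)

text \<open>The KMS-type relation: cycling \<open>x\<close> around the trace past the density
  \<open>Q\<close> conjugates it to \<open>Q ** x ** Qi\<close>.\<close>

lemma modular: "x \<in> B \<Longrightarrow> y \<in> B \<Longrightarrow> \<psi> (y ** Q ** x ** Qi) = \<psi> (x ** y)"
proof -
  assume xy: "x \<in> B" "y \<in> B"
  have "\<psi> (y ** Q ** x ** Qi) = Tr (Q ** y ** Q ** x ** Qi)"
    using xy by (simp add: \<psi>_Tr matrix_mul_assoc)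
  also have "\<dots> = Tr (Qi ** (Q ** y ** Q ** x))"
    using xy by (intro tr) simp_all
  also have "\<dots> = Tr (y ** (Q ** x))"
    by (simp add: matrix_mul_assoc Qi)
  also have "\<dots> = Tr (Q ** x ** y)"
    using xy by (subst tr) simp_all
  finally show ?thesis using xy by (simp add: \<psi>_Tr matrix_mul_assoc)
qed

text \<open>By \<open>modular\<close> the coefficient at \<open>(i, k)\<close> is also that of
  \<open>c ** Q ** adj (g k) ** Qi\<close> at \<open>g i\<close>. This form puts \<open>c\<close> in
  the first leg.\<close>

lemma adj_mult_op_right:
  assumes "c \<in> B"
  shows "adj m *v \<Lambda> c = (\<Sum>k\<in>UNIV. vtens (\<Lambda> (c ** Q ** adj (g k) ** Qi)) (\<Lambda> (g k)))"
proof -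
  have "\<psi> (adj (g i) ** (c ** Q ** adj (g k) ** Qi)) = \<psi> (adj (g k) ** adj (g i) ** c)" for i k
    using modular[of "adj (g k)" "adj (g i) ** c"] assms by (simp add: matrix_mul_assoc)
  then have "(\<Sum>j\<in>UNIV. vtens (\<Lambda> (c ** Q ** adj (g j) ** Qi)) (\<Lambda> (g j))) $ (i, k)
      = (adj m *v \<Lambda> c) $ (i, k)" for i k
    using assms
    by (simp add: sum_component vtens_component mult.commute[of _ "axis _ 1 $ _"]
        axis_sum_nth adj_mult_op_nth Lambda_nth)
  then show ?thesis by (simp add: vec_eq_iff)
qed

end

section \<open>Operators as vectors, and the action of the tensor algebra on them\<close>

lemma vtens_sum_left: "vtens (\<Sum>i\<in>I. f i) y = (\<Sum>i\<in>I. vtens (f i) y)"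
  by (simp add: vtens_def vec_eq_iff sum_component sum_distrib_right)

lemma hs_vec_inject [simp]: "hs_vec S = hs_vec T \<longleftrightarrow> S = T"
  by (auto simp: hs_vec_def vec_eq_iff)

lemma hs_vec_surj: "\<exists>T. v = hs_vec T"
  by (rule exI[of _ "\<chi> i j. v $ (i, j)"]) (simp add: hs_vec_def vec_eq_iff)

lemma hs_vec_sum: "hs_vec (\<Sum>i\<in>I. f i) = (\<Sum>i\<in>I. hs_vec (f i))"
  by (simp add: hs_vec_def vec_eq_iff sum_component)

text \<open>Turns the action on \<open>H \<otimes> H-bar\<close> into two-sided multiplication of
  operators; the reversed product of the second leg is composition of right multiplications.\<close>

lemma kron_transpose_hs_vec: "kron a (transpose b) *v hs_vec T = hs_vec (a ** T ** b)"
proof -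
  have "(\<Sum>p\<in>UNIV. a $ i $ fst p * b $ snd p $ j * T $ fst p $ snd p)
      = (\<Sum>q\<in>UNIV. (\<Sum>p\<in>UNIV. a $ i $ p * T $ p $ q) * b $ q $ j)" for i j
    unfolding UNIV_Times_UNIV[symmetric] sum_distrib_right
    by (subst sum.swap) (simp add: sum.cartesian_product case_prod_beta mult_ac)
  then show ?thesis
    by (simp add: kron_def transpose_def hs_vec_def vec_eq_iff matrix_vector_mult_def
        matrix_matrix_mult_def)
qed

lemma op_action_sum_hs_vec:
  "op_action (\<Sum>j\<in>J. kron (a j) (b j)) *v hs_vec T = hs_vec (\<Sum>j\<in>J. a j ** T ** b j)"
proof -
  have "op_action (\<Sum>j\<in>J. kron (a j) (b j)) = (\<Sum>j\<in>J. op_action (kron (a j) (b j)))"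
    by (simp add: op_action_def vec_eq_iff sum_component)
  then show ?thesis
    by (simp add: op_action_kron matrix_sum_vector_mult kron_transpose_hs_vec hs_vec_sum)
qed

lemma mult_map_sum: "mult_map (\<Sum>j\<in>J. f j) = (\<Sum>j\<in>J. mult_map (f j))"
  by (simp add: mult_map_def vec_eq_iff sum_component) (intro allI sum.swap)

lemma left_amp_sigma_sum:
  "left_amp (sigma_aut Q z) (\<Sum>j\<in>J. f j) = (\<Sum>j\<in>J. left_amp (sigma_aut Q z) (f j))"
proof (induction J rule: infinite_finite_induct)
  case (insert x F)
  then show ?case by (simp add: left_amp_add sigma_add)
qed (simp_all add: left_amp_def sigma_aut_def vec_eq_iff matrix_matrix_mult_def)

section \<open>The operator \<open>A\<close> as a linear map on \<open>B\<close>\<close>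

context gns_algebra
begin

definition act :: "'d cmat \<Rightarrow> 'n cmat \<Rightarrow> 'n cmat" where
  "act A x = inv_into B \<Lambda> (A *v \<Lambda> x)"

lemma act_in [simp]: "act A x \<in> B" and Lambda_act [simp]: "\<Lambda> (act A x) = A *v \<Lambda> x"
proof -
  have "\<Lambda> ` B = UNIV" using gns by (simp add: gns_map_def bij_betw_def)
  then show "act A x \<in> B" "\<Lambda> (act A x) = A *v \<Lambda> x"
    by (auto simp: act_def intro!: inv_into_into f_inv_into_f)
qed

lemma act_expand:
  assumes "c \<in> B"
  shows "act A c = (\<Sum>j\<in>UNIV. msc (\<psi> (adj (g j) ** c)) (act A (g j)))"
proof -
  have "\<Lambda> c = (\<Sum>j\<in>UNIV. \<psi> (adj (g j) ** c) *s \<Lambda> (g j))"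
    using gns_sum[OF alg gns, of UNIV g "\<lambda>j. \<psi> (adj (g j) ** c)"] expand[OF assms]
    by (simp only: g_in finite)
  then have "\<Lambda> (act A c) = \<Lambda> (\<Sum>j\<in>UNIV. msc (\<psi> (adj (g j) ** c)) (act A (g j)))"
    by (subst gns_sum[OF alg gns]) (simp_all add: matrix_vector_mult_sum vec.scale)
  then show ?thesis by (subst (asm) Lambda_inj) simp_all
qed

lemma act_g: "act A (g j) = (\<Sum>i\<in>UNIV. msc (A $ i $ j) (g i))"
proof -
  have "\<Lambda> (act A (g j)) $ i = A $ i $ j" for i
    by (simp add: matrix_vector_mult_def axis_def if_distrib cong: if_cong)
  then show ?thesis using gns_expand[OF alg gns, of "act A (g j)"] by simp
qed

text \<open>The entries in column \<open>j\<close> of \<open>A\<close> are collected into the single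
  element \<open>act A (g j)\<close>.\<close>

lemma Psi_act: "Psi Q B \<Lambda> A = (\<Sum>j\<in>UNIV. kron (adj (g j)) (sigma_aut Q (\<i> / 2) (act A (g j))))"
  unfolding Psi_def act_g sigma_sum sigma_msc
  by (subst sum.swap) (simp add: kron_def msc_def vec_eq_iff sum_component sum_distrib_left mult_ac)

lemma Psi'_act: "Psi' Q B \<Lambda> A = (\<Sum>j\<in>UNIV. kron (sigma_aut Q (\<i> / 2) (act A (g j))) (adj (g j)))"
  unfolding Psi'_def act_g sigma_sum sigma_msc
  by (subst sum.swap) (simp add: kron_def msc_def vec_eq_iff sum_component sum_distrib_left mult_ac)

text \<open>In \<open>adj_mult_op_left\<close> the element \<open>c\<close> sits in the second leg,
  untouched by \<open>A\<close> on the first, so the result is a left multiplication.\<close>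

lemma mult_left_amplification:
  assumes "c \<in> B"
  shows "(m ** kron A (mat 1) ** adj m) *v \<Lambda> c = \<Lambda> ((\<Sum>j\<in>UNIV. act A (g j) ** adj (g j)) ** c)"
proof -
  have "(m ** kron A (mat 1) ** adj m) *v \<Lambda> c
      = (\<Sum>j\<in>UNIV. m *v vtens (\<Lambda> (act A (g j))) (\<Lambda> (adj (g j) ** c)))"
    using assms by (simp add: adj_mult_op_left matrix_vector_mult_sum kron_vtens
        flip: matrix_vector_mul_assoc)
  also have "\<dots> = \<Lambda> (\<Sum>j\<in>UNIV. act A (g j) ** adj (g j) ** c)"
    using assms by (subst mult_op_Lambda) (simp_all add: Lambda_sum matrix_mul_assoc)
  finally show ?thesis by (simp add: sum_mult_matrix)
qed

text \<open>Here \<open>c\<close> stays inside \<open>A\<close>. The formula is evaluated at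
  \<open>c = 1\<close>, to be compared with the one obtained from
  \<open>adj_mult_op_right\<close>.\<close>

lemma mult_right_amplification:
  assumes "c \<in> B"
  shows "(m ** kron (mat 1) A ** adj m) *v \<Lambda> c = \<Lambda> (\<Sum>j\<in>UNIV. g j ** act A (adj (g j) ** c))"
proof -
  have "(m ** kron (mat 1) A ** adj m) *v \<Lambda> c
      = (\<Sum>j\<in>UNIV. m *v vtens (\<Lambda> (g j)) (\<Lambda> (act A (adj (g j) ** c))))"
    using assms by (simp add: adj_mult_op_left matrix_vector_mult_sum kron_vtens
        flip: matrix_vector_mul_assoc)
  also have "\<dots> = \<Lambda> (\<Sum>j\<in>UNIV. g j ** act A (adj (g j) ** c))"
    using assms by (subst mult_op_Lambda) (simp_all add: Lambda_sum)
  finally show ?thesis .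
qed

lemma mult_left_amplification_eq_1:
  "m ** kron A (mat 1) ** adj m = mat 1 \<longleftrightarrow> (\<Sum>j\<in>UNIV. act A (g j) ** adj (g j)) = mat 1"
proof -
  have "m ** kron A (mat 1) ** adj m = mat 1
      \<longleftrightarrow> (\<forall>c\<in>B. (\<Sum>j\<in>UNIV. act A (g j) ** adj (g j)) ** c = c)"
    by (simp add: matrix_eq_Lambda mult_left_amplification Lambda_inj)
  also have "\<dots> \<longleftrightarrow> (\<Sum>j\<in>UNIV. act A (g j) ** adj (g j)) = mat 1"
    by (auto dest: bspec[OF _ B_one])
  finally show ?thesis .
qed

lemma schur_idempotent_act:
  assumes "m ** kron A A ** adj m = A" "c \<in> B"
  shows "act A c = (\<Sum>j\<in>UNIV. act A (g j) ** act A (adj (g j) ** c))"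
proof -
  have "A *v \<Lambda> c = (m ** kron A A ** adj m) *v \<Lambda> c" by (simp add: assms(1))
  also have "\<dots> = (\<Sum>j\<in>UNIV. m *v vtens (\<Lambda> (act A (g j))) (\<Lambda> (act A (adj (g j) ** c))))"
    using assms(2) by (simp add: adj_mult_op_left matrix_vector_mult_sum kron_vtens
        flip: matrix_vector_mul_assoc)
  also have "\<dots> = \<Lambda> (\<Sum>j\<in>UNIV. act A (g j) ** act A (adj (g j) ** c))"
    using assms(2) by (subst mult_op_Lambda) (simp_all add: Lambda_sum)
  finally have "\<Lambda> (act A c) = \<Lambda> (\<Sum>j\<in>UNIV. act A (g j) ** act A (adj (g j) ** c))" by simp
  then show ?thesis by (subst (asm) Lambda_inj) simp_all
qed

text \<open>Idempotency of \<open>A\<close> for the Schur product, tested against an arbitrary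
  bilinear \<open>\<beta>\<close>, so that it covers the actions of both candidates for
  \<open>e\<close>.\<close>

lemma schur_idempotent_bilinear:
  fixes \<beta> :: "'n cmat \<Rightarrow> 'n cmat \<Rightarrow> 'n cmat"
  assumes A: "m ** kron A A ** adj m = A"
    and sum_l: "\<And>f y. \<beta> (\<Sum>i\<in>UNIV. f (i :: 'd)) y = (\<Sum>i\<in>UNIV. \<beta> (f i) y)"
    and sum_r: "\<And>f x. \<beta> x (\<Sum>i\<in>UNIV. f (i :: 'd)) = (\<Sum>i\<in>UNIV. \<beta> x (f i))"
    and msc_l: "\<And>c x y. \<beta> (msc c x) y = msc c (\<beta> x y)"
    and msc_r: "\<And>c x y. \<beta> x (msc c y) = msc c (\<beta> x y)"
  shows "(\<Sum>j\<in>UNIV. \<Sum>l\<in>UNIV. \<beta> (adj (g l) ** adj (g j)) (act A (g j) ** act A (g l)))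
    = (\<Sum>s\<in>UNIV. \<beta> (adj (g s)) (act A (g s)))"
proof -
  have act: "act A (g s) = (\<Sum>j\<in>UNIV. \<Sum>l\<in>UNIV.
      msc (\<psi> (adj (g l) ** adj (g j) ** g s)) (act A (g j) ** act A (g l)))" for s
    by (subst schur_idempotent_act[OF A], simp, subst act_expand)
      (simp_all add: matrix_mult_sum msc_mult_right matrix_mul_assoc)
  have "(\<Sum>s\<in>UNIV. \<beta> (adj (g s)) (act A (g s))) = (\<Sum>s\<in>UNIV. \<Sum>j\<in>UNIV. \<Sum>l\<in>UNIV.
      \<beta> (msc (\<psi> (adj (g l) ** adj (g j) ** g s)) (adj (g s))) (act A (g j) ** act A (g l)))"
    by (subst act) (simp add: sum_r msc_l msc_r)
  also have "\<dots> = (\<Sum>j\<in>UNIV. \<Sum>s\<in>UNIV. \<Sum>l\<in>UNIV.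
      \<beta> (msc (\<psi> (adj (g l) ** adj (g j) ** g s)) (adj (g s))) (act A (g j) ** act A (g l)))"
    by (rule sum.swap)
  also have "\<dots> = (\<Sum>j\<in>UNIV. \<Sum>l\<in>UNIV. \<Sum>s\<in>UNIV.
      \<beta> (msc (\<psi> (adj (g l) ** adj (g j) ** g s)) (adj (g s))) (act A (g j) ** act A (g l)))"
    by (intro sum.cong refl sum.swap)
  \<comment> \<open>For fixed \<open>j\<close> and \<open>l\<close> the sum over \<open>s\<close> is
    the expansion of \<open>adj (g l) ** adj (g j)\<close>.\<close>
  also have "\<dots> = (\<Sum>j\<in>UNIV. \<Sum>l\<in>UNIV. \<beta> (adj (g l) ** adj (g j)) (act A (g j) ** act A (g l)))"
    by (simp add: expand_adj flip: sum_l)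
  finally show ?thesis by simp
qed

lemma adj_unit_op_Lambda: "y \<in> B \<Longrightarrow> (adj (unit_op \<Lambda>) *v \<Lambda> y) $ 1 = \<psi> y"
proof -
  assume y: "y \<in> B"
  have "(adj (unit_op \<Lambda>) *v \<Lambda> y) $ 1 = cip (\<Lambda> (mat 1)) (\<Lambda> y)"
    by (simp add: adj_def unit_op_def matrix_vector_mult_def cip_def)
  then show ?thesis using y by (simp add: cip_Lambda)
qed

text \<open>Comparing coefficients with \<open>expand\<close>, the hypothesis says that
  \<open>act A\<close> is symmetric for the bilinear form \<open>\<psi> (x ** y)\<close>.\<close>

lemma conjugate_act:
  assumes A: "runit ** kron (mat 1) (adj (unit_op \<Lambda>) ** m) ** kron (mat 1) (kron A (mat 1)) ** assoc
      ** kron (adj m ** unit_op \<Lambda>) (mat 1) ** lunit_inv = A"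
    and c: "c \<in> B"
  shows "act A c = (\<Sum>i\<in>UNIV. msc (\<psi> (act A (adj (g i)) ** c)) (g i))"
proof -
  let ?\<eta> = "unit_op \<Lambda>"
  have \<eta>: "?\<eta> *v 1 = \<Lambda> (mat 1)" by (simp add: unit_op_apply)
  have "A *v \<Lambda> c = (runit ** kron (mat 1) (adj ?\<eta> ** m) ** kron (mat 1) (kron A (mat 1)) ** assoc
      ** kron (adj m ** ?\<eta>) (mat 1) ** lunit_inv) *v \<Lambda> c"
    by (simp only: A)
  also have "\<dots> = (\<Sum>i\<in>UNIV. runit *v vtens (\<Lambda> (g i))
      (adj ?\<eta> *v (m *v vtens (\<Lambda> (act A (adj (g i)))) (\<Lambda> c))))"
    by (simp add: lunit_inv_apply kron_vtens \<eta> adj_mult_op_left vtens_sum_left assoc_apply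
        matrix_vector_mult_sum flip: matrix_vector_mul_assoc)
  also have "\<dots> = (\<Sum>i\<in>UNIV. \<psi> (act A (adj (g i)) ** c) *s \<Lambda> (g i))"
    using c by (subst mult_op_Lambda) (simp_all add: runit_apply adj_unit_op_Lambda)
  also have "\<dots> = \<Lambda> (\<Sum>i\<in>UNIV. msc (\<psi> (act A (adj (g i)) ** c)) (g i))"
    by (subst gns_sum[OF alg gns]) simp_all
  finally have "\<Lambda> (act A c) = \<Lambda> (\<Sum>i\<in>UNIV. msc (\<psi> (act A (adj (g i)) ** c)) (g i))" by simp
  then show ?thesis by (subst (asm) Lambda_inj) simp_all
qed

text \<open>Expanding \<open>act A (g i)\<close> by \<open>conjugate_act\<close> and then summing
  over \<open>i\<close> with \<open>expand_adj\<close> moves \<open>A\<close> onto the adjoint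
  basis.\<close>

lemma conjugate_sum_act:
  assumes A: "runit ** kron (mat 1) (adj (unit_op \<Lambda>) ** m) ** kron (mat 1) (kron A (mat 1)) ** assoc
      ** kron (adj m ** unit_op \<Lambda>) (mat 1) ** lunit_inv = A"
  shows "(\<Sum>i\<in>UNIV. act A (g i) ** adj (g i)) = (\<Sum>j\<in>UNIV. g j ** act A (adj (g j)))"
proof -
  have "(\<Sum>i\<in>UNIV. act A (g i) ** adj (g i))
      = (\<Sum>i\<in>UNIV. \<Sum>j\<in>UNIV. g j ** msc (\<psi> (act A (adj (g j)) ** g i)) (adj (g i)))"
    by (subst conjugate_act[OF A]) (simp_all add: sum_mult_matrix msc_mult_left msc_mult_right)
  also have "\<dots> = (\<Sum>j\<in>UNIV. g j ** (\<Sum>i\<in>UNIV. msc (\<psi> (act A (adj (g j)) ** g i)) (adj (g i))))"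
    by (subst sum.swap) (simp add: matrix_mult_sum)
  finally show ?thesis by (simp add: expand_adj)
qed

end

section \<open>Comparison of the two amplifications of \<open>A\<close>\<close>

context gns_trace
begin

lemma mult_right_amplification':
  assumes "c \<in> B"
  shows "(m ** kron (mat 1) A ** adj m) *v \<Lambda> c
    = \<Lambda> (c ** (\<Sum>j\<in>UNIV. Q ** adj (g j) ** Qi ** act A (g j)))"
proof -
  have "(m ** kron (mat 1) A ** adj m) *v \<Lambda> c
      = (\<Sum>j\<in>UNIV. m *v vtens (\<Lambda> (c ** Q ** adj (g j) ** Qi)) (\<Lambda> (act A (g j))))"
    using assms by (simp add: adj_mult_op_right matrix_vector_mult_sum kron_vtens
        flip: matrix_vector_mul_assoc)
  also have "\<dots> = \<Lambda> (\<Sum>j\<in>UNIV. c ** Q ** adj (g j) ** Qi ** act A (g j))"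
    using assms by (subst mult_op_Lambda) (simp_all add: Lambda_sum)
  finally show ?thesis by (simp add: matrix_mult_sum matrix_mul_assoc)
qed

lemma mult_right_amplification_eq_1:
  "m ** kron (mat 1) A ** adj m = mat 1
    \<longleftrightarrow> (\<Sum>j\<in>UNIV. Q ** adj (g j) ** Qi ** act A (g j)) = mat 1"
proof -
  have "m ** kron (mat 1) A ** adj m = mat 1
      \<longleftrightarrow> (\<forall>c\<in>B. c ** (\<Sum>j\<in>UNIV. Q ** adj (g j) ** Qi ** act A (g j)) = c)"
    by (simp add: matrix_eq_Lambda mult_right_amplification' Lambda_inj)
  also have "\<dots> \<longleftrightarrow> (\<Sum>j\<in>UNIV. Q ** adj (g j) ** Qi ** act A (g j)) = mat 1"
    by (auto dest: bspec[OF _ B_one])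
  finally show ?thesis .
qed

text \<open>The two formulas for the right amplification agree at \<open>c = 1\<close>, and
  \<open>conjugate_sum_act\<close> identifies the result with the sum for the left one. Hence the
  two forms of (1) agree.\<close>

lemma degree_sums_eq:
  assumes A: "runit ** kron (mat 1) (adj (unit_op \<Lambda>) ** m) ** kron (mat 1) (kron A (mat 1)) ** assoc
      ** kron (adj m ** unit_op \<Lambda>) (mat 1) ** lunit_inv = A"
  shows "(\<Sum>j\<in>UNIV. Q ** adj (g j) ** Qi ** act A (g j)) = (\<Sum>j\<in>UNIV. act A (g j) ** adj (g j))"
proof -
  have "\<Lambda> (\<Sum>j\<in>UNIV. Q ** adj (g j) ** Qi ** act A (g j)) = \<Lambda> (\<Sum>j\<in>UNIV. g j ** act A (adj (g j)))"
    using mult_right_amplification[of "mat 1" A] mult_right_amplification'[of "mat 1" A] by simp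
  then show ?thesis
    unfolding conjugate_sum_act[OF A] by (subst (asm) Lambda_inj) simp_all
qed

end

section \<open>The vectors \<open>u0\<close> and \<open>u1\<close>, and ranges of
  idempotents\<close>

lemma sum_theta_orthonormal_basis:
  fixes b :: "'j::finite \<Rightarrow> complex ^ 'n::finite"
  assumes "orthonormal_basis b"
  shows "(\<Sum>j\<in>UNIV. theta (b j) (b j)) = mat 1"
proof (rule orthonormal_complete_sum)
  fix x
  assume x: "\<And>j. j \<in> UNIV \<Longrightarrow> cip (b j) x = 0"
  have "cip y x = 0" if "y \<in> vec.span (range b)" for y
    using that
    by (induction rule: vec.span_induct_alt) (auto simp: cip_add_left cip_scale_left x)
  then show "x = 0"
    using assms by (metis UNIV_I cip_self_eq_0 orthonormal_basis_def)
qed (use assms in \<open>auto simp: orthonormal_basis_def\<close>)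

text \<open>Both sums are resolutions of the identity multiplied by a matrix, hence independent of
  the basis; they coincide when \<open>M\<close> is self-adjoint.\<close>

lemma sum_vtens_cbar_basis:
  fixes b :: "'j::finite \<Rightarrow> complex ^ 'n::finite"
  assumes "orthonormal_basis b"
  shows "(\<Sum>j\<in>UNIV. vtens (b j) (cbar (M *v b j))) = hs_vec (adj M)"
    and "(\<Sum>j\<in>UNIV. vtens (M *v b j) (cbar (b j))) = hs_vec M"
proof -
  have "theta (M *v x) x = theta x x ** adj M" for x :: "complex ^ 'n"
    by (simp add: theta_mult_matrix)
  then show "(\<Sum>j\<in>UNIV. vtens (b j) (cbar (M *v b j))) = hs_vec (adj M)"
    by (simp add: sum_theta_orthonormal_basis[OF assms] flip: hs_vec_theta hs_vec_sum sum_mult_matrix)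
  show "(\<Sum>j\<in>UNIV. vtens (M *v b j) (cbar (b j))) = hs_vec M"
    by (simp add: sum_theta_orthonormal_basis[OF assms]
        flip: hs_vec_theta hs_vec_sum matrix_mult_theta matrix_mult_sum)
qed

text \<open>The range of an idempotent is its set of fixed vectors; this links (2) with (3).\<close>

lemma range_idempotent_op_action:
  assumes e: "\<And>T. op_action e *v hs_vec T = hs_vec (L T)" and L: "\<And>T. L (L T) = L T"
  shows "hs_vec T \<in> range (\<lambda>v. op_action e *v v) \<longleftrightarrow> op_action e *v hs_vec T = hs_vec T"
proof
  assume "hs_vec T \<in> range (\<lambda>v. op_action e *v v)"
  then obtain S where "hs_vec T = op_action e *v hs_vec S" by (metis imageE hs_vec_surj)
  then show "op_action e *v hs_vec T = hs_vec T" by (simp add: e L)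
qed (metis rangeI)

section \<open>The action of \<open>e\<close> on operators\<close>

context gns_trace
begin

context
  fixes P R :: "'n cmat"
  assumes PR: "P ** R = mat 1" and RP: "R ** P = mat 1" and RR: "R ** R = Qi"
    and sigma_pos: "\<And>a. sigma_aut Q (\<i> / 2) a = R ** a ** P"
    and sigma_neg: "\<And>a. sigma_aut Q (- \<i> / 2) a = P ** a ** R"
begin

lemma PR_cancel [simp]: "x ** P ** R = x" "x ** R ** P = x"
  by (simp_all add: PR RP flip: matrix_mul_assoc)

text \<open>\<open>P\<close> and \<open>R\<close> stand for the powers of \<open>Q\<close> with
  exponents 1/2 and -1/2, so the bracketed factor is \<open>sigma_aut Q (\<i> / 2)\<close> of
  \<open>act A (g j)\<close>.\<close>

definition Psi_map :: "'d cmat \<Rightarrow> 'n cmat \<Rightarrow> 'n cmat" where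
  "Psi_map A T = (\<Sum>j\<in>UNIV. adj (g j) ** T ** (R ** act A (g j) ** P))"

definition Psi'_map :: "'d cmat \<Rightarrow> 'n cmat \<Rightarrow> 'n cmat" where
  "Psi'_map A T = (\<Sum>j\<in>UNIV. R ** act A (g j) ** P ** T ** adj (g j))"

lemma op_action_Psi: "op_action (Psi Q B \<Lambda> A) *v hs_vec T = hs_vec (Psi_map A T)"
  by (simp add: Psi_act op_action_sum_hs_vec Psi_map_def sigma_pos)

lemma op_action_Psi': "op_action (Psi' Q B \<Lambda> A) *v hs_vec T = hs_vec (Psi'_map A T)"
  by (simp add: Psi'_act op_action_sum_hs_vec Psi'_map_def sigma_pos)

lemma Psi_map_idem:
  assumes "m ** kron A A ** adj m = A"
  shows "Psi_map A (Psi_map A T) = Psi_map A T"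
proof -
  define \<beta> where "\<beta> x y = x ** T ** (R ** y ** P)" for x y :: "'n cmat"
  have "Psi_map A (Psi_map A T) = (\<Sum>l\<in>UNIV. \<Sum>j\<in>UNIV.
      \<beta> (adj (g l) ** adj (g j)) (act A (g j) ** act A (g l)))"
    by (simp add: Psi_map_def \<beta>_def matrix_mult_sum sum_mult_matrix matrix_mul_assoc)
  \<comment> \<open>The outer application contributes the index \<open>l\<close>, since its left
    factor stands outermost while its right factor comes last.\<close>
  also have "\<dots> = (\<Sum>j\<in>UNIV. \<Sum>l\<in>UNIV.
      \<beta> (adj (g l) ** adj (g j)) (act A (g j) ** act A (g l)))"
    by (rule sum.swap)
  also have "\<dots> = (\<Sum>s\<in>UNIV. \<beta> (adj (g s)) (act A (g s)))"
    by (rule schur_idempotent_bilinear[OF assms])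
      (simp_all add: \<beta>_def matrix_mult_sum sum_mult_matrix msc_mult_left msc_mult_right)
  finally show ?thesis by (simp add: Psi_map_def \<beta>_def)
qed

lemma Psi'_map_idem:
  assumes "m ** kron A A ** adj m = A"
  shows "Psi'_map A (Psi'_map A T) = Psi'_map A T"
proof -
  define \<beta> where "\<beta> x y = R ** y ** P ** T ** x" for x y :: "'n cmat"
  have "Psi'_map A (Psi'_map A T) = (\<Sum>j\<in>UNIV. \<Sum>l\<in>UNIV.
      \<beta> (adj (g l) ** adj (g j)) (act A (g j) ** act A (g l)))"
    by (simp add: Psi'_map_def \<beta>_def matrix_mult_sum sum_mult_matrix matrix_mul_assoc)
  also have "\<dots> = (\<Sum>s\<in>UNIV. \<beta> (adj (g s)) (act A (g s)))"
    by (rule schur_idempotent_bilinear[OF assms])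
      (simp_all add: \<beta>_def matrix_mult_sum sum_mult_matrix msc_mult_left msc_mult_right)
  finally show ?thesis by (simp add: Psi'_map_def \<beta>_def)
qed

text \<open>At \<open>T = R\<close> the two adjacent factors \<open>R\<close> merge into
  \<open>Qi\<close>, which produces the sum of the right amplification.\<close>

lemma Psi_map_fixes:
  "Psi_map A R = R \<longleftrightarrow> (\<Sum>j\<in>UNIV. Q ** adj (g j) ** Qi ** act A (g j)) = mat 1" (is "_ \<longleftrightarrow> ?X = _")
proof -
  have "Psi_map A R = (\<Sum>j\<in>UNIV. adj (g j) ** Qi ** act A (g j)) ** P"
    by (simp add: Psi_map_def sum_mult_matrix matrix_mul_assoc flip: RR)
  moreover have "?X = Q ** (\<Sum>j\<in>UNIV. adj (g j) ** Qi ** act A (g j))"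
    by (simp add: matrix_mult_sum matrix_mul_assoc)
  \<comment> \<open>Each side says that \<open>S\<close> is \<open>R ** R\<close>, the inverse of
    \<open>Q\<close>.\<close>
  moreover have "S ** P = R \<longleftrightarrow> Q ** S = mat 1" for S
  proof
    assume "S ** P = R"
    then have "S ** P ** R = Qi" by (simp only: RR)
    then show "Q ** S = mat 1" by (simp add: Qi)
  next
    assume "Q ** S = mat 1"
    then have "Qi ** (Q ** S) = Qi" by simp
    then have "S = R ** R" by (simp add: matrix_mul_assoc Qi RR)
    then show "S ** P = R" by simp
  qed
  ultimately show ?thesis by simp
qed

lemma Psi'_map_fixes:
  "Psi'_map A R = R \<longleftrightarrow> (\<Sum>j\<in>UNIV. act A (g j) ** adj (g j)) = mat 1" (is "_ \<longleftrightarrow> ?Y = _")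
proof -
  have "Psi'_map A R = R ** ?Y"
    by (simp add: Psi'_map_def matrix_mult_sum matrix_mul_assoc)
  moreover have "R ** S = R \<longleftrightarrow> S = mat 1" for S
    by (metis PR matrix_mul_assoc matrix_mul_lid matrix_mul_rid)
  ultimately show ?thesis by simp
qed

text \<open>Twisting the first leg puts \<open>P\<close> in front of it and \<open>R\<close> between
  the legs, so multiplying out is the action on \<open>R\<close> preceded by \<open>P\<close>. Thus
  (5) becomes a fixed-point condition.\<close>

lemma mult_map_Psi:
  "mult_map (left_amp (sigma_aut Q (- \<i> / 2)) (Psi Q B \<Lambda> A)) = P ** Psi_map A R"
  by (simp only: Psi_act left_amp_sigma_sum left_amp_sigma_kron mult_map_sum mult_map_kron
      Psi_map_def matrix_mult_sum sigma_pos sigma_neg matrix_mul_assoc)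

lemma mult_map_Psi':
  "mult_map (left_amp (sigma_aut Q (- \<i> / 2)) (Psi' Q B \<Lambda> A)) = P ** Psi'_map A R"
  by (simp only: Psi'_act left_amp_sigma_sum left_amp_sigma_kron mult_map_sum mult_map_kron
      Psi'_map_def matrix_mult_sum sigma_pos sigma_neg matrix_mul_assoc)

lemma P_mult_eq_1: "P ** S = mat 1 \<longleftrightarrow> S = R"
  by (metis PR RP matrix_mul_assoc matrix_mul_lid matrix_mul_rid)

end

end

theorem proposition5p25:
  fixes B :: "'n::finite cmat set" and Tr \<psi> :: "'n cmat \<Rightarrow> complex" and Q :: "'n cmat"
    and \<Lambda> :: "'n cmat \<Rightarrow> complex ^ 'd::finite" and A :: "'d cmat"
    and m :: "complex ^ ('d \<times> 'd) ^ 'd" and \<eta> :: "complex ^ 1 ^ 'd"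
    and e :: "('n \<times> 'n) cmat" and V :: "(complex ^ ('n \<times> 'n)) set" and S :: "'n cmat set"
    and b :: "'j::finite \<Rightarrow> complex ^ 'n" and u0 u1 :: "complex ^ ('n \<times> 'n)"
  assumes "unital_star_subalgebra B" and "is_block_trace B Tr" and "faithful_state B \<psi>"
    and "Q \<in> B" and "positive_op Q" and "invertible Q" and "\<forall>a\<in>B. \<psi> a = Tr (Q ** a)"
    and "gns_map B \<psi> \<Lambda>" and "m = mult_op B \<Lambda>" and "\<eta> = unit_op \<Lambda>"
    and "adj A = A"
    and "m ** kron A A ** adj m = A"
    and "runit ** kron (mat 1) (adj \<eta> ** m) ** kron (mat 1) (kron A (mat 1)) ** assoc
           ** kron (adj m ** \<eta>) (mat 1) ** lunit_inv = A"
    and "e = Psi Q B \<Lambda> A \<or> e = Psi' Q B \<Lambda> A"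
    and "V = range (\<lambda>v. op_action e *v v)"
    and "S = {T. hs_vec T \<in> V}"
    and "orthonormal_basis b"
    and "u0 = (\<Sum>j\<in>UNIV. vtens (b j) (cbar (mpow Q (- 1 / 2) *v b j)))"
    and "u1 = (\<Sum>j\<in>UNIV. vtens (mpow Q (- 1 / 2) *v b j) (cbar (b j)))"
  defines "c1 \<equiv> m ** kron A (mat 1) ** adj m = mat 1"
    and "c1' \<equiv> m ** kron (mat 1) A ** adj m = mat 1"
    and "c2 \<equiv> op_action e *v u0 = u0"
    and "c2' \<equiv> op_action e *v u1 = u1"
    and "c3 \<equiv> u0 \<in> V"
    and "c3' \<equiv> u1 \<in> V"
    and "c4 \<equiv> mpow Q (- 1 / 2) \<in> S"
    and "c5 \<equiv> mult_map (left_amp (sigma_aut Q (- \<i> / 2)) e) = mat 1"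
  shows "(c1 \<longleftrightarrow> c1') \<and> (c2 \<longleftrightarrow> c2') \<and> (c3 \<longleftrightarrow> c3') \<and>
         (c1 \<longleftrightarrow> c2) \<and> (c2 \<longleftrightarrow> c3) \<and> (c3 \<longleftrightarrow> c4) \<and> (c4 \<longleftrightarrow> c5)"
proof -
  note Q = \<open>positive_op Q\<close> \<open>invertible Q\<close>
  define P R where "P = mpow Q (1 / 2)" and "R = mpow Q (- 1 / 2)"
  have PR: "P ** R = mat 1" and RP: "R ** P = mat 1"
    using mpow_add[OF Q, of "1 / 2" "- 1 / 2"] mpow_add[OF Q, of "- 1 / 2" "1 / 2"] mpow_0[OF Q]
    by (simp_all add: P_def R_def)
  have PP: "P ** P = Q"
    using mpow_add[OF Q, of "1 / 2" "1 / 2"] by (simp add: P_def mpow_1[OF Q])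
  have adj_R: "adj R = R" by (simp add: R_def adj_mpow[OF Q])
  have QR: "Q ** (R ** R) = mat 1" "(R ** R) ** Q = mat 1"
    by (metis PP PR RP matrix_mul_assoc matrix_mul_rid)+
  \<comment> \<open>The exponent in \<open>sigma_aut\<close> is \<open>\<i> * z\<close>, so
    \<open>z = \<i> / 2\<close> puts the negative power \<open>R\<close> on the left.\<close>
  have "\<i> * (\<i> / 2) = - 1 / 2" "- (\<i> * (\<i> / 2)) = 1 / 2"
    "\<i> * (- \<i> / 2) = 1 / 2" "- (\<i> * (- \<i> / 2)) = - 1 / 2"
    by simp_all
  then have sigma: "sigma_aut Q (\<i> / 2) a = R ** a ** P" "sigma_aut Q (- \<i> / 2) a = P ** a ** R" for a
    by (simp_all only: sigma_aut_def P_def R_def)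
  \<comment> \<open>The inverse of \<open>Q\<close> is taken to be \<open>R ** R\<close>, so the
    assumption on it in the inner context holds by \<open>refl\<close>.\<close>
  interpret gns_trace B \<psi> \<Lambda> Tr Q "R ** R"
    using assms(1,4,7,8) block_trace_commute[OF assms(2)] QR by unfold_locales auto
  note PR' = PR RP refl[of "R ** R"] sigma
  note [simp] = \<open>m = mult_op B \<Lambda>\<close> \<open>\<eta> = unit_op \<Lambda>\<close>
  note A2 = assms(12)[simplified] and A3 = assms(13)[unfolded assms(9,10)]
  \<comment> \<open>The first sum gives \<open>adj R\<close> and the second \<open>R\<close>; these
    agree because the exponent -1/2 is real.\<close>
  have u: "u0 = hs_vec R" "u1 = hs_vec R"
    using sum_vtens_cbar_basis[OF assms(17), of R] assms(18,19)[folded R_def] by (simp_all add: adj_R)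
  have c1: "c1 \<longleftrightarrow> (\<Sum>j\<in>UNIV. act A (gns_inv B \<Lambda> j) ** adj (gns_inv B \<Lambda> j)) = mat 1"
    by (simp add: c1_def mult_left_amplification_eq_1)
  have c1': "c1' \<longleftrightarrow> c1"
    unfolding c1 degree_sums_eq[OF A3, symmetric]
    by (simp add: c1'_def mult_right_amplification_eq_1)
  \<comment> \<open>From here both choices of \<open>e\<close> are treated alike, through the
    idempotent action \<open>L\<close> on operators.\<close>
  obtain L where e: "\<And>T. op_action e *v hs_vec T = hs_vec (L T)" and L: "\<And>T. L (L T) = L T"
    and fixes_R: "L R = R \<longleftrightarrow> c1"
    and mult: "mult_map (left_amp (sigma_aut Q (- \<i> / 2)) e) = P ** L R"
  proof (cases "e = Psi Q B \<Lambda> A")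
    case True
    \<comment> \<open>\<open>Psi_map_fixes\<close> gives the second form of (1), which
      \<open>degree_sums_eq\<close> converts into the first.\<close>
    show thesis
      by (rule that[of "Psi_map P R A"])
        (use Psi_map_fixes[OF PR', of A] degree_sums_eq[OF A3] in
          \<open>simp_all only: True c1 op_action_Psi[OF PR'] Psi_map_idem[OF PR' A2] mult_map_Psi[OF PR']\<close>)
  next
    case False
    then have e: "e = Psi' Q B \<Lambda> A" using assms(14) by blast
    show thesis
      by (rule that[of "Psi'_map P R A"])
        (simp_all only: e c1 op_action_Psi'[OF PR'] Psi'_map_idem[OF PR' A2] mult_map_Psi'[OF PR']
          Psi'_map_fixes[OF PR'])
  qed
  have c2: "c2 \<longleftrightarrow> c1" "c2' \<longleftrightarrow> c1"
    by (simp_all add: c2_def c2'_def u e fixes_R)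
  have c3: "c3 \<longleftrightarrow> c1" "c3' \<longleftrightarrow> c1" "c4 \<longleftrightarrow> c1"
    using range_idempotent_op_action[OF e L, of R]
    by (simp_all only: c3_def c3'_def c4_def u assms(15,16) mem_Collect_eq e hs_vec_inject fixes_R
        flip: R_def)
  have "c5 \<longleftrightarrow> c1"
    by (simp only: c5_def mult P_mult_eq_1[OF PR'] fixes_R)
  then show ?thesis using c1' c2 c3 by blast
qed

end
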